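(* Let $n\ge 1$ and let $D\subset\mathbb{R}^n$ be a measurable set of finite Lebesgue measure $V$ (not necessarily bounded). Let $\mathcal{H}_D\subset L^2(\mathbb{R}^n)$ be the closed subspace of those $f$ whose Fourier transform $\hat f$ vanishes almost everywhere on $\mathbb{R}^n\setminus D$. Then: 1. each $f\in\mathcal{H}_D$ has a unique continuous representative, and it is given by $$f(x)=\int_{\mathbb{R}^n}\hat f(k)\,e^{2\pi i\,x\cdot k}\,dk\qquad(x\in\mathbb{R}^n);$$ 2. with elements identified with their continuous representatives, $\mathcal{H}_D$ is a reproducing kernel Hilbert space on $\mathbb{R}^n$ with reproducing kernel $K(x,y)=g_D(x-y)$, where $g_D(x)=\int_D e^{2\pi i\,k\cdot x}\,dk$; 3. for every $f\in\mathcal{H}_D$, $\|f\|_\infty\le V^{1/2}\,\|f\|_2$.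
   Context: The inner product on $L^2$ is $\langle f\mid g\rangle=\int f\,\overline{g}$, linear in the first variable. The Fourier transform on $\mathbb{R}^n$ is $\hat f(k)=\int_{\mathbb{R}^n}f(x)e^{-2\pi i\,k\cdot x}\,dx$ for $f\in L^1\cap L^2$, extended to a unitary operator on $L^2(\mathbb{R}^n)$. $g_D$ is the inverse Fourier transform of the indicator function $1_D$. That $\mathcal{H}_D$ is a reproducing kernel Hilbert space with kernel $K$ means that for every $x$ the function $y\mapsto K(y,x)$ belongs to $\mathcal{H}_D$ and $f(x)=\langle f\mid K(\cdot,x)\rangle=\int_{\mathbb{R}^n}K(x,y)f(y)\,dy$ for all $f\in\mathcal{H}_D$. *)

theory Defs
  imports "HOL-Analysis.Analysis" "HOL-Probability.Essential_Supremum"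
begin

section \<open>Square-integrable functions on $\mathbb{R}^n$\<close>

text \<open>Elements of \<open>L\<^sup>2\<close> are represented by functions; equality in \<open>L\<^sup>2\<close> is equality
  almost everywhere.\<close>

definition L2_fun :: "(real ^ 'n \<Rightarrow> complex) set" where
  "L2_fun = {f. f \<in> borel_measurable lebesgue \<and> integrable lebesgue (\<lambda>x. (cmod (f x))\<^sup>2)}"

definition L2_inner :: "(real ^ 'n \<Rightarrow> complex) \<Rightarrow> (real ^ 'n \<Rightarrow> complex) \<Rightarrow> complex" where
  "L2_inner f g = (LINT x|lebesgue. f x * cnj (g x))"

definition L2_norm :: "(real ^ 'n \<Rightarrow> complex) \<Rightarrow> real" where
  "L2_norm f = sqrt (LINT x|lebesgue. (cmod (f x))\<^sup>2)"

text \<open>Membership in \<^const>\<open>L2_fun\<close> is part of the notion, because the Bochner integral of a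
  non-integrable function is 0.\<close>

definition L2_tendsto :: "(nat \<Rightarrow> real ^ 'n \<Rightarrow> complex) \<Rightarrow> (real ^ 'n \<Rightarrow> complex) \<Rightarrow> bool" where
  "L2_tendsto F f \<longleftrightarrow>
     (\<forall>m. F m \<in> L2_fun) \<and> f \<in> L2_fun \<and> (\<lambda>m. L2_norm (\<lambda>x. F m x - f x)) \<longlonglongrightarrow> 0"

definition L2_Cauchy :: "(nat \<Rightarrow> real ^ 'n \<Rightarrow> complex) \<Rightarrow> bool" where
  "L2_Cauchy F \<longleftrightarrow>
     (\<forall>m. F m \<in> L2_fun) \<and>
     (\<forall>e>0. \<exists>N. \<forall>m\<ge>N. \<forall>l\<ge>N. L2_norm (\<lambda>x. F m x - F l x) < e)"

definition L2_linear_subspace :: "(real ^ 'n \<Rightarrow> complex) set \<Rightarrow> bool" where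
  "L2_linear_subspace H \<longleftrightarrow>
     H \<subseteq> L2_fun \<and> (\<lambda>x. 0) \<in> H \<and>
     (\<forall>f\<in>H. \<forall>g\<in>H. (\<lambda>x. f x + g x) \<in> H) \<and>
     (\<forall>c. \<forall>f\<in>H. (\<lambda>x. c * f x) \<in> H)"

definition L2_closed_subspace :: "(real ^ 'n \<Rightarrow> complex) set \<Rightarrow> bool" where
  "L2_closed_subspace H \<longleftrightarrow>
     L2_linear_subspace H \<and> (\<forall>F f. (\<forall>m. F m \<in> H) \<and> L2_tendsto F f \<longrightarrow> f \<in> H)"

section \<open>The Fourier transform\<close>

definition fourier_L1 :: "(real ^ 'n \<Rightarrow> complex) \<Rightarrow> real ^ 'n \<Rightarrow> complex" where
  "fourier_L1 f k =
     (LINT x|lebesgue. f x * exp (- 2 * complex_of_real pi * \<i> * complex_of_real (k \<bullet> x)))"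

text \<open>The extension by continuity from \<open>L\<^sup>1 \<inter> L\<^sup>2\<close> to \<open>L\<^sup>2\<close>: the transform of \<open>f\<close> is the
  \<open>L\<^sup>2\<close>-limit of the transforms of integrable functions that tend to \<open>f\<close> in \<open>L\<^sup>2\<close>. By
  Plancherel's theorem this limit exists and, up to a null set, does not depend on the approximating
  sequence; the choice operator picks one representative.\<close>

definition fourier_L2 :: "(real ^ 'n \<Rightarrow> complex) \<Rightarrow> real ^ 'n \<Rightarrow> complex" where
  "fourier_L2 f =
     (SOME h. \<exists>F. (\<forall>m. integrable lebesgue (F m)) \<and> L2_tendsto F f \<and>
                   L2_tendsto (\<lambda>m. fourier_L1 (F m)) h)"

section \<open>Functions with spectrum in a set\<close>

definition spectral_space :: "(real ^ 'n) set \<Rightarrow> (real ^ 'n \<Rightarrow> complex) set" where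
  "spectral_space D = {f \<in> L2_fun. AE k in lebesgue. k \<notin> D \<longrightarrow> fourier_L2 f k = 0}"

definition is_cont_rep :: "(real ^ 'n \<Rightarrow> complex) \<Rightarrow> (real ^ 'n \<Rightarrow> complex) \<Rightarrow> bool" where
  "is_cont_rep f h \<longleftrightarrow> continuous_on UNIV h \<and> (AE x in lebesgue. h x = f x)"

definition cont_rep :: "(real ^ 'n \<Rightarrow> complex) \<Rightarrow> real ^ 'n \<Rightarrow> complex" where
  "cont_rep f = (THE h. is_cont_rep f h)"

definition g_kernel :: "(real ^ 'n) set \<Rightarrow> real ^ 'n \<Rightarrow> complex" where
  "g_kernel D x =
     (LINT k:D|lebesgue. exp (2 * complex_of_real pi * \<i> * complex_of_real (k \<bullet> x)))"

section \<open>Reproducing kernel Hilbert spaces inside \<open>L\<^sup>2\<close>\<close>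

text \<open>Elements are genuine functions here, so the inner product has to be definite pointwise and not
  only up to null sets.\<close>

definition L2_function_Hilbert_space :: "(real ^ 'n \<Rightarrow> complex) set \<Rightarrow> bool" where
  "L2_function_Hilbert_space H \<longleftrightarrow>
     L2_linear_subspace H \<and>
     (\<forall>f\<in>H. L2_inner f f = 0 \<longrightarrow> (\<forall>x. f x = 0)) \<and>
     (\<forall>F. (\<forall>m. F m \<in> H) \<and> L2_Cauchy F \<longrightarrow> (\<exists>f\<in>H. L2_tendsto F f))"

definition L2_RKHS ::
  "(real ^ 'n \<Rightarrow> complex) set \<Rightarrow> (real ^ 'n \<Rightarrow> real ^ 'n \<Rightarrow> complex) \<Rightarrow> bool" where
  "L2_RKHS H K \<longleftrightarrow>
     L2_function_Hilbert_space H \<and>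
     (\<forall>x. (\<lambda>y. K y x) \<in> H) \<and>
     (\<forall>f\<in>H. \<forall>x. f x = L2_inner f (\<lambda>y. K y x) \<and>
                f x = (LINT y|lebesgue. K x y * f y))"

definition Linfty_norm :: "(real ^ 'n \<Rightarrow> complex) \<Rightarrow> ereal" where
  "Linfty_norm f = esssup lebesgue (\<lambda>x. ereal (cmod (f x)))"

end

theory Submission
  imports Defs "HOL-Probability.Characteristic_Functions"
begin

text \<open>The crux is Plancherel's theorem: for integrable \<open>f\<close> with transform \<open>f^\<close> and autocorrelation \<open>A\<close>,
  \<open>\<integral> |f^(k)|\<^sup>2 exp (-\<pi>|s k|\<^sup>2) dk = \<integral> A(s w) exp (-\<pi>|w|\<^sup>2) dw\<close>, and \<open>s \<rightarrow> 0\<close> gives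
  \<open>\<parallel>f^\<parallel> = \<parallel>f\<parallel>\<close> for continuous \<open>f\<close> of compact support, hence by density on \<open>L\<^sup>1 \<inter> L\<^sup>2\<close> and on
  \<open>L\<^sup>2\<close>. Since the inverse transform is adjoint to the transform, inversion holds almost everywhere
  as soon as \<open>f^\<close> is integrable. If \<open>f^\<close> is supported in \<open>D\<close>, it is integrable by Cauchy--Schwarz,
  with \<open>\<parallel>f^\<parallel>\<^sub>1 \<le> V\<^sup>1\<^sup>/\<^sup>2 \<parallel>f\<parallel>\<^sub>2\<close>, so \<open>f\<close> has the inverse transform of \<open>f^\<close> as its continuous
  representative; its value at \<open>x\<close> is the inner product of \<open>f^\<close> with the transform of
  \<open>g\<^sub>D(\<cdot> - x)\<close>.\<close>

section \<open>The space $L^2$\<close>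

text \<open>The transform of an integrable function is a priori only bounded and continuous, so its
  square cannot be integrated directly. The Gaussian factor makes every integral absolutely
  convergent, and \<open>gauss\<close> is its own transform, so the damped integral can be rewritten
  in terms of the autocorrelation near 0. As s decreases to 0 the damped integrand increases, so
  monotone convergence yields the integrability of the squared transform together with the value of
  its integral. A second obstacle is that \<open>g_kernel D\<close> need not be integrable even
  though it is square-integrable: its transform exists only as an L2 limit. Identifying it requires
  showing that the inverse transform of a function that is both integrable and square-integrable is
  carried back to that function. Since \<open>fourier_L2\<close> is picked by choice, the arguments
  run through the relation \<open>fourier_rel\<close>, which does not refer to a chosen
  representative.\<close>

lemma L2_fun_measurable: "f \<in> L2_fun \<Longrightarrow> f \<in> borel_measurable lebesgue"
  by (simp add: L2_fun_def)

lemma L2_fun_integrable: "f \<in> L2_fun \<Longrightarrow> integrable lebesgue (\<lambda>x. (cmod (f x))\<^sup>2)"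
  by (simp add: L2_fun_def)

lemma L2_fun_zero: "(\<lambda>x. 0) \<in> L2_fun"
  by (simp add: L2_fun_def)

lemma L2_fun_dominated:
  assumes "f \<in> borel_measurable lebesgue" and "integrable lebesgue w"
    and "AE x in lebesgue. (cmod (f x))\<^sup>2 \<le> w x"
  shows "f \<in> L2_fun"
proof -
  have [measurable]: "f \<in> borel_measurable lebesgue" by fact
  have "integrable lebesgue (\<lambda>x. (cmod (f x))\<^sup>2)"
    by (rule Bochner_Integration.integrable_bound[OF assms(2)]) (use assms(3) in auto)
  then show ?thesis using assms(1) by (simp add: L2_fun_def)
qed

lemma L2_fun_scale:
  assumes "f \<in> L2_fun" shows "(\<lambda>x. c * f x) \<in> L2_fun"
proof -
  have [measurable]: "f \<in> borel_measurable lebesgue" using assms by (rule L2_fun_measurable)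
  show ?thesis
    using L2_fun_integrable[OF assms] by (auto simp: L2_fun_def norm_mult power_mult_distrib)
qed

lemma L2_fun_cnj: "f \<in> L2_fun \<Longrightarrow> (\<lambda>x. cnj (f x)) \<in> L2_fun"
  by (auto simp: L2_fun_def intro!: borel_measurable_continuous_on[OF continuous_on_cnj[OF continuous_on_id]])

lemma cmod_add_square_le: "(cmod (a + b))\<^sup>2 \<le> 2 * (cmod a)\<^sup>2 + 2 * (cmod b)\<^sup>2"
proof -
  have "(cmod (a + b))\<^sup>2 \<le> (cmod a + cmod b)\<^sup>2"
    by (intro power_mono norm_triangle_ineq) auto
  also have "\<dots> \<le> 2 * (cmod a)\<^sup>2 + 2 * (cmod b)\<^sup>2"
    using sum_squares_bound[of "cmod a" "cmod b"] by (simp add: power2_sum)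
  finally show ?thesis .
qed

lemma L2_fun_add:
  assumes "f \<in> L2_fun" "g \<in> L2_fun" shows "(\<lambda>x. f x + g x) \<in> L2_fun"
proof (rule L2_fun_dominated)
  show "(\<lambda>x. f x + g x) \<in> borel_measurable lebesgue"
    using assms[THEN L2_fun_measurable] by measurable
  show "integrable lebesgue (\<lambda>x. 2 * (cmod (f x))\<^sup>2 + 2 * (cmod (g x))\<^sup>2)"
    using assms[THEN L2_fun_integrable] by auto
qed (simp add: cmod_add_square_le)

lemma L2_fun_diff:
  assumes "f \<in> L2_fun" "g \<in> L2_fun" shows "(\<lambda>x. f x - g x) \<in> L2_fun"
  using L2_fun_add[OF assms(1) L2_fun_scale[OF assms(2), of "-1"]] by simp

lemma L2_fun_cong_AE:
  assumes "f \<in> L2_fun" "AE x in lebesgue. f x = g x" shows "g \<in> L2_fun"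
proof (rule L2_fun_dominated[OF _ L2_fun_integrable[OF assms(1)]])
  show "g \<in> borel_measurable lebesgue"
    by (rule borel_measurable_AE[OF L2_fun_measurable[OF assms(1)] assms(2)])
qed (use assms(2) in auto)

lemma L2_norm_nonneg: "0 \<le> L2_norm f"
  by (simp add: L2_norm_def)

lemma L2_norm_square: "(L2_norm f)\<^sup>2 = (LINT x|lebesgue. (cmod (f x))\<^sup>2)"
  by (simp add: L2_norm_def)

lemma L2_norm_cong_AE:
  assumes [measurable]: "f \<in> borel_measurable lebesgue" and "AE x in lebesgue. f x = g x"
  shows "L2_norm f = L2_norm g"
proof -
  have [measurable]: "g \<in> borel_measurable lebesgue"
    by (rule borel_measurable_AE[OF assms])
  show ?thesis unfolding L2_norm_def
    by (intro arg_cong[where f = sqrt] integral_cong_AE) (use assms(2) in auto)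
qed

lemma L2_norm_scale: "L2_norm (\<lambda>x. c * f x) = cmod c * L2_norm f"
  by (simp add: L2_norm_def norm_mult power_mult_distrib real_sqrt_mult)

lemma L2_norm_minus_commute: "L2_norm (\<lambda>x. f x - g x) = L2_norm (\<lambda>x. g x - f x)"
  by (simp add: L2_norm_def norm_minus_commute)

lemma L2_norm_eq_0_iff:
  assumes "f \<in> L2_fun" shows "L2_norm f = 0 \<longleftrightarrow> (AE x in lebesgue. f x = 0)"
  using integral_nonneg_eq_0_iff_AE[OF L2_fun_integrable[OF assms]] by (simp add: L2_norm_def)

section \<open>Products, the inner product and the Cauchy-Schwarz inequality\<close>

lemma integrable_L2_mult:
  assumes "f \<in> L2_fun" "g \<in> L2_fun" shows "integrable lebesgue (\<lambda>x. f x * g x)"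
proof (rule Bochner_Integration.integrable_bound)
  show "integrable lebesgue (\<lambda>x. (cmod (f x))\<^sup>2 + (cmod (g x))\<^sup>2)"
    using assms[THEN L2_fun_integrable] by auto
  show "(\<lambda>x. f x * g x) \<in> borel_measurable lebesgue"
    using assms[THEN L2_fun_measurable] by measurable
  show "AE x in lebesgue. norm (f x * g x) \<le> norm ((cmod (f x))\<^sup>2 + (cmod (g x))\<^sup>2)"
  proof (rule AE_I2)
    fix x
    have "2 * (cmod (f x) * cmod (g x)) \<le> (cmod (f x))\<^sup>2 + (cmod (g x))\<^sup>2"
      using sum_squares_bound[of "cmod (f x)" "cmod (g x)"] by (simp add: mult.assoc)
    moreover have "0 \<le> cmod (f x) * cmod (g x)" by simp
    ultimately have "cmod (f x) * cmod (g x) \<le> (cmod (f x))\<^sup>2 + (cmod (g x))\<^sup>2"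
      by linarith
    then show "norm (f x * g x) \<le> norm ((cmod (f x))\<^sup>2 + (cmod (g x))\<^sup>2)"
      by (simp add: norm_mult)
  qed
qed

lemma integrable_L2_inner:
  "f \<in> L2_fun \<Longrightarrow> g \<in> L2_fun \<Longrightarrow> integrable lebesgue (\<lambda>x. f x * cnj (g x))"
  by (rule integrable_L2_mult[OF _ L2_fun_cnj])

text \<open>Integrating the square of t|f| - |g|, divided by t, gives a bound for every t > 0. The
  choice t = ||g|| / ||f|| makes both terms of the bound equal to ||f|| ||g||; it requires nonzero
  norms, so the degenerate case is treated apart.\<close>

lemma L2_Cauchy_Schwarz:
  assumes f: "f \<in> L2_fun" and g: "g \<in> L2_fun"
  shows "(LINT x|lebesgue. cmod (f x) * cmod (g x)) \<le> L2_norm f * L2_norm g"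
proof -
  let ?I = "LINT x|lebesgue. cmod (f x) * cmod (g x)"
  have int: "integrable lebesgue (\<lambda>x. cmod (f x) * cmod (g x))"
    using integrable_norm[OF integrable_L2_mult[OF f g]] by (simp add: norm_mult)
  have bound: "2 * ?I \<le> t * (L2_norm f)\<^sup>2 + (L2_norm g)\<^sup>2 / t" if t: "t > 0" for t
  proof -
    have "2 * ?I = (LINT x|lebesgue. 2 * (cmod (f x) * cmod (g x)))" by simp
    also have "\<dots> \<le> (LINT x|lebesgue. t * (cmod (f x))\<^sup>2 + (cmod (g x))\<^sup>2 / t)"
    proof (rule integral_mono)
      show "integrable lebesgue (\<lambda>x. t * (cmod (f x))\<^sup>2 + (cmod (g x))\<^sup>2 / t)"
        using f g by (simp add: L2_fun_integrable)
      show "integrable lebesgue (\<lambda>x. 2 * (cmod (f x) * cmod (g x)))"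
        using int by simp
      fix x
      have "0 \<le> (t * cmod (f x) - cmod (g x))\<^sup>2 / t" using t by simp
      also have "\<dots> = t * (cmod (f x))\<^sup>2 + (cmod (g x))\<^sup>2 / t - 2 * (cmod (f x) * cmod (g x))"
        using t by (simp add: power2_eq_square field_simps)
      finally show "2 * (cmod (f x) * cmod (g x)) \<le> t * (cmod (f x))\<^sup>2 + (cmod (g x))\<^sup>2 / t"
        by simp
    qed
    also have "\<dots> = t * (L2_norm f)\<^sup>2 + (L2_norm g)\<^sup>2 / t"
      using f g by (simp add: L2_norm_square L2_fun_integrable)
    finally show ?thesis .
  qed
  show ?thesis
  proof (cases "L2_norm f = 0 \<or> L2_norm g = 0")
    case True
    then have "AE x in lebesgue. f x * g x = 0"
      using L2_norm_eq_0_iff[OF f] L2_norm_eq_0_iff[OF g] by auto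
    then have "?I = 0" 
      by (intro integral_eq_zero_AE) auto
    then show ?thesis by (simp add: L2_norm_nonneg)
  next
    case False
    then have pos: "L2_norm f > 0" "L2_norm g > 0"
      using L2_norm_nonneg[of f] L2_norm_nonneg[of g] by linarith+
    then show ?thesis
      using bound[of "L2_norm g / L2_norm f"] by (simp add: power2_eq_square field_simps)
  qed
qed

lemma cmod_L2_inner_le:
  assumes f: "f \<in> L2_fun" and g: "g \<in> L2_fun"
  shows "cmod (L2_inner f g) \<le> L2_norm f * L2_norm g"
proof -
  have "cmod (L2_inner f g) \<le> (LINT x|lebesgue. cmod (f x * cnj (g x)))"
    unfolding L2_inner_def by (rule integral_norm_bound)
  also have "\<dots> = (LINT x|lebesgue. cmod (f x) * cmod (g x))"
    by (simp add: norm_mult)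
  also have "\<dots> \<le> L2_norm f * L2_norm g" by (rule L2_Cauchy_Schwarz[OF f g])
  finally show ?thesis .
qed

lemma L2_inner_self: "L2_inner f f = complex_of_real ((L2_norm f)\<^sup>2)"
  by (simp add: L2_inner_def L2_norm_square complex_norm_square[symmetric]
        flip: integral_complex_of_real)

lemma L2_inner_diff_left:
  assumes "f \<in> L2_fun" "g \<in> L2_fun" "h \<in> L2_fun"
  shows "L2_inner (\<lambda>x. f x - g x) h = L2_inner f h - L2_inner g h"
  using assms by (simp add: L2_inner_def integrable_L2_inner algebra_simps)

lemma L2_inner_diff_right:
  assumes "f \<in> L2_fun" "g \<in> L2_fun" "h \<in> L2_fun"
  shows "L2_inner h (\<lambda>x. f x - g x) = L2_inner h f - L2_inner h g"
  using assms by (simp add: L2_inner_def integrable_L2_inner algebra_simps)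

lemma L2_inner_commute: "L2_inner f g = cnj (L2_inner g f)"
proof -
  have "L2_inner f g = (LINT x|lebesgue. cnj (g x * cnj (f x)))"
    by (simp add: L2_inner_def mult.commute)
  then show ?thesis by (simp only: Bochner_Integration.integral_cnj L2_inner_def)
qed

text \<open>The free scalar serves three purposes: c = 1 gives the triangle inequality, c = 1 and c
  = \<i> together recover the inner product from norms, and c = -1 expresses the distance of two
  functions.\<close>

lemma L2_norm_add_square:
  fixes f g :: "real ^ 'n \<Rightarrow> complex"
  assumes "f \<in> L2_fun" "g \<in> L2_fun"
  shows "(L2_norm (\<lambda>x. f x + c * g x))\<^sup>2 =
    (L2_norm f)\<^sup>2 + 2 * Re (cnj c * L2_inner f g) + (cmod c)\<^sup>2 * (L2_norm g)\<^sup>2"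
proof -
  have eq: "(cmod (f x + c * g x))\<^sup>2 =
      (cmod (f x))\<^sup>2 + 2 * Re (cnj c * (f x * cnj (g x))) + (cmod c)\<^sup>2 * (cmod (g x))\<^sup>2" for x
    unfolding cmod_power2 by (simp add: power2_eq_square algebra_simps)
  have int: "integrable lebesgue (\<lambda>x. cnj c * (f x * cnj (g x)))"
    using integrable_L2_inner[OF assms] by simp
  have lin: "(LINT x|lebesgue. A x + 2 * B x + k * C x) =
      (LINT x|lebesgue. A x) + 2 * (LINT x|lebesgue. B x) + k * (LINT x|lebesgue. C x)"
    if "integrable lebesgue A" "integrable lebesgue B" "integrable lebesgue C"
    for A B C :: "real ^ 'n \<Rightarrow> real" and k
    using that by simp
  have "(L2_norm (\<lambda>x. f x + c * g x))\<^sup>2 = (LINT x|lebesgue. (cmod (f x))\<^sup>2)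
      + 2 * (LINT x|lebesgue. Re (cnj c * (f x * cnj (g x))))
      + (cmod c)\<^sup>2 * (LINT x|lebesgue. (cmod (g x))\<^sup>2)"
    unfolding L2_norm_square eq
    by (rule lin) (rule L2_fun_integrable integrable_Re int assms)+
  also have "(LINT x|lebesgue. Re (cnj c * (f x * cnj (g x)))) = Re (cnj c * L2_inner f g)"
    unfolding L2_inner_def by (simp only: integral_Re[OF int] Bochner_Integration.integral_mult_right_zero)
  finally show ?thesis by (simp add: L2_norm_square)
qed

lemma L2_norm_triangle:
  assumes "f \<in> L2_fun" "g \<in> L2_fun"
  shows "L2_norm (\<lambda>x. f x + g x) \<le> L2_norm f + L2_norm g"
proof (rule power2_le_imp_le)
  have "Re (L2_inner f g) \<le> L2_norm f * L2_norm g"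
    using complex_Re_le_cmod cmod_L2_inner_le[OF assms] by (rule order_trans)
  then show "(L2_norm (\<lambda>x. f x + g x))\<^sup>2 \<le> (L2_norm f + L2_norm g)\<^sup>2"
    using L2_norm_add_square[OF assms, of 1] by (simp add: power2_sum)
qed (simp add: L2_norm_nonneg)

lemma L2_norm_triangle_diff:
  assumes "f \<in> L2_fun" "g \<in> L2_fun" "h \<in> L2_fun"
  shows "L2_norm (\<lambda>x. f x - h x) \<le> L2_norm (\<lambda>x. f x - g x) + L2_norm (\<lambda>x. g x - h x)"
  using L2_norm_triangle[OF L2_fun_diff[OF assms(1,2)] L2_fun_diff[OF assms(2,3)]] by simp

lemma L2_norm_diff_ge:
  assumes "f \<in> L2_fun" "g \<in> L2_fun"
  shows "\<bar>L2_norm f - L2_norm g\<bar> \<le> L2_norm (\<lambda>x. f x - g x)"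
  using L2_norm_triangle_diff[OF assms L2_fun_zero] L2_norm_triangle_diff[OF assms(2,1) L2_fun_zero]
    L2_norm_minus_commute[of f g] by simp

section \<open>Convergence in the norm\<close>

lemma L2_tendsto_norm:
  assumes "L2_tendsto F f" shows "(\<lambda>m. L2_norm (F m)) \<longlonglongrightarrow> L2_norm f"
proof (rule LIM_zero_cancel, rule Lim_null_comparison)
  show "\<forall>\<^sub>F m in sequentially. norm (L2_norm (F m) - L2_norm f) \<le> L2_norm (\<lambda>x. F m x - f x)"
    using assms by (auto simp: L2_tendsto_def intro!: always_eventually L2_norm_diff_ge)
  show "(\<lambda>m. L2_norm (\<lambda>x. F m x - f x)) \<longlonglongrightarrow> 0" using assms by (simp add: L2_tendsto_def)
qed

lemma L2_tendsto_inner: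
  assumes "L2_tendsto F f" "L2_tendsto G g"
  shows "(\<lambda>m. L2_inner (F m) (G m)) \<longlonglongrightarrow> L2_inner f g"
proof (rule LIM_zero_cancel, rule Lim_null_comparison)
  have L2: "F m \<in> L2_fun" "f \<in> L2_fun" "G m \<in> L2_fun" "g \<in> L2_fun" for m
    using assms by (auto simp: L2_tendsto_def)
  have lim: "(\<lambda>m. L2_norm (\<lambda>x. F m x - f x)) \<longlonglongrightarrow> 0" "(\<lambda>m. L2_norm (\<lambda>x. G m x - g x)) \<longlonglongrightarrow> 0"
    using assms by (simp_all add: L2_tendsto_def)
  let ?b = "\<lambda>m. L2_norm (\<lambda>x. F m x - f x) * L2_norm (G m)
      + L2_norm f * L2_norm (\<lambda>x. G m x - g x)"
  show "\<forall>\<^sub>F m in sequentially. norm (L2_inner (F m) (G m) - L2_inner f g) \<le> ?b m"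
  proof (rule always_eventually, rule allI)
    fix m
    have "L2_inner (F m) (G m) - L2_inner f g =
        L2_inner (\<lambda>x. F m x - f x) (G m) + L2_inner f (\<lambda>x. G m x - g x)"
      by (simp add: L2_inner_diff_left L2_inner_diff_right L2)
    also have "cmod \<dots> \<le> ?b m"
      by (intro norm_triangle_le add_mono cmod_L2_inner_le L2 L2_fun_diff)
    finally show "norm (L2_inner (F m) (G m) - L2_inner f g) \<le> ?b m" .
  qed
  have "?b \<longlonglongrightarrow> 0 * L2_norm g + L2_norm f * 0"
    by (intro tendsto_intros lim L2_tendsto_norm assms)
  then show "?b \<longlonglongrightarrow> 0" by simp
qed

lemma L2_tendsto_const: "f \<in> L2_fun \<Longrightarrow> L2_tendsto (\<lambda>m. f) f"
  by (simp add: L2_tendsto_def L2_norm_def)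

lemma L2_tendsto_add:
  assumes "L2_tendsto F f" "L2_tendsto G g"
  shows "L2_tendsto (\<lambda>m x. F m x + G m x) (\<lambda>x. f x + g x)"
proof -
  have L2: "F m \<in> L2_fun" "f \<in> L2_fun" "G m \<in> L2_fun" "g \<in> L2_fun" for m
    using assms by (auto simp: L2_tendsto_def)
  have "(\<lambda>m. L2_norm (\<lambda>x. F m x - f x) + L2_norm (\<lambda>x. G m x - g x)) \<longlonglongrightarrow> 0 + 0"
    by (rule tendsto_add) (use assms in \<open>auto simp: L2_tendsto_def\<close>)
  then have lim: "(\<lambda>m. L2_norm (\<lambda>x. F m x - f x) + L2_norm (\<lambda>x. G m x - g x)) \<longlonglongrightarrow> 0"
    by simp
  have "L2_norm (\<lambda>x. (F m x + G m x) - (f x + g x))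
      \<le> L2_norm (\<lambda>x. F m x - f x) + L2_norm (\<lambda>x. G m x - g x)" for m
    using L2_norm_triangle[OF L2_fun_diff[OF L2(1,2)] L2_fun_diff[OF L2(3,4)], of m m]
    by (simp add: add_diff_add)
  then have "(\<lambda>m. L2_norm (\<lambda>x. (F m x + G m x) - (f x + g x))) \<longlonglongrightarrow> 0"
    by (intro Lim_null_comparison[OF _ lim] always_eventually) (simp add: L2_norm_nonneg)
  then show ?thesis using L2 by (simp add: L2_tendsto_def L2_fun_add)
qed

lemma L2_tendsto_scale:
  assumes "L2_tendsto F f" shows "L2_tendsto (\<lambda>m x. c * F m x) (\<lambda>x. c * f x)"
proof -
  have "(\<lambda>m. cmod c * L2_norm (\<lambda>x. F m x - f x)) \<longlonglongrightarrow> cmod c * 0"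
    by (rule tendsto_mult_left) (use assms in \<open>auto simp: L2_tendsto_def\<close>)
  moreover have "L2_norm (\<lambda>x. c * F m x - c * f x) = cmod c * L2_norm (\<lambda>x. F m x - f x)" for m
    using L2_norm_scale[of c "\<lambda>x. F m x - f x"] by (simp add: right_diff_distrib)
  ultimately show ?thesis using assms by (simp add: L2_tendsto_def L2_fun_scale)
qed

lemma L2_tendsto_cong_AE:
  assumes "L2_tendsto F f" "AE x in lebesgue. f x = g x" shows "L2_tendsto F g"
proof -
  have L2: "F m \<in> L2_fun" "f \<in> L2_fun" for m
    using assms by (auto simp: L2_tendsto_def)
  have "L2_norm (\<lambda>x. F m x - f x) = L2_norm (\<lambda>x. F m x - g x)" for m
    by (rule L2_norm_cong_AE[OF L2_fun_measurable[OF L2_fun_diff[OF L2]]]) (use assms(2) in auto)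
  then show ?thesis using assms L2_fun_cong_AE[OF L2(2) assms(2)] by (simp add: L2_tendsto_def)
qed

section \<open>Cauchy sequences and completeness\<close>

lemma L2_tendsto_imp_Cauchy:
  assumes "L2_tendsto F f" shows "L2_Cauchy F"
  unfolding L2_Cauchy_def
proof (intro conjI allI impI)
  have L2: "F m \<in> L2_fun" "f \<in> L2_fun" for m
    using assms by (auto simp: L2_tendsto_def)
  then show "F m \<in> L2_fun" for m by simp
  fix e :: real assume "e > 0"
  then have "\<forall>\<^sub>F m in sequentially. L2_norm (\<lambda>x. F m x - f x) < e / 2"
    using assms by (intro order_tendstoD(2)[where y = 0]) (auto simp: L2_tendsto_def)
  then obtain N where N: "\<And>m. m \<ge> N \<Longrightarrow> L2_norm (\<lambda>x. F m x - f x) < e / 2"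
    by (auto simp: eventually_sequentially)
  have "L2_norm (\<lambda>x. F m x - F l x) < e" if "m \<ge> N" "l \<ge> N" for m l
    using L2_norm_triangle_diff[OF L2(1)[of m] L2(2) L2(1)[of l]] N[OF that(1)] N[OF that(2)]
      L2_norm_minus_commute[of f "F l"] by simp
  then show "\<exists>N. \<forall>m\<ge>N. \<forall>l\<ge>N. L2_norm (\<lambda>x. F m x - F l x) < e" by blast
qed

text \<open>This is Fatou's lemma for the squared moduli. The bound is asked only eventually, so
  that the lemma applies to differences of a fixed and a late member of a Cauchy sequence and passes
  to the limit in the late one.\<close>

lemma L2_Fatou:
  assumes F: "\<And>m. F m \<in> L2_fun" and f [measurable]: "f \<in> borel_measurable lebesgue"
    and lim: "AE x in lebesgue. (\<lambda>m. F m x) \<longlonglongrightarrow> f x"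
    and bound: "\<forall>\<^sub>F m in sequentially. L2_norm (F m) \<le> B"
  shows "f \<in> L2_fun" "L2_norm f \<le> B"
proof -
  have [measurable]: "F m \<in> borel_measurable lebesgue" for m by (rule L2_fun_measurable[OF F])
  have "\<exists>m. L2_norm (F m) \<le> B"
    using eventually_happens[OF bound] by simp
  then have B: "B \<ge> 0" using L2_norm_nonneg order_trans by blast
  have "(\<integral>\<^sup>+x. ennreal ((cmod (f x))\<^sup>2) \<partial>lebesgue)
      = (\<integral>\<^sup>+x. liminf (\<lambda>m. ennreal ((cmod (F m x))\<^sup>2)) \<partial>lebesgue)"
  proof (rule nn_integral_cong_AE)
    show "AE x in lebesgue. ennreal ((cmod (f x))\<^sup>2) = liminf (\<lambda>m. ennreal ((cmod (F m x))\<^sup>2))"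
      using lim
    proof eventually_elim
      fix x assume "(\<lambda>m. F m x) \<longlonglongrightarrow> f x"
      then have "(\<lambda>m. ennreal ((cmod (F m x))\<^sup>2)) \<longlonglongrightarrow> ennreal ((cmod (f x))\<^sup>2)"
        by (intro tendsto_intros)
      then show "ennreal ((cmod (f x))\<^sup>2) = liminf (\<lambda>m. ennreal ((cmod (F m x))\<^sup>2))"
        by (rule lim_imp_Liminf[OF sequentially_bot, symmetric])
    qed
  qed
  also have "\<dots> \<le> liminf (\<lambda>m. \<integral>\<^sup>+x. ennreal ((cmod (F m x))\<^sup>2) \<partial>lebesgue)"
    by (rule nn_integral_liminf) auto
  also have "\<dots> = liminf (\<lambda>m. ennreal ((L2_norm (F m))\<^sup>2))"
    by (simp add: L2_norm_square nn_integral_eq_integral[OF L2_fun_integrable[OF F]])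
  also have "\<dots> \<le> ennreal (B\<^sup>2)"
  proof -
    have "liminf (\<lambda>m. ennreal ((L2_norm (F m))\<^sup>2)) \<le> liminf (\<lambda>m. ennreal (B\<^sup>2))"
      by (rule Liminf_mono, rule eventually_mono[OF bound])
        (auto intro!: ennreal_leI power_mono L2_norm_nonneg)
    then show ?thesis by (simp add: Liminf_const)
  qed
  finally have le: "(\<integral>\<^sup>+x. ennreal ((cmod (f x))\<^sup>2) \<partial>lebesgue) \<le> ennreal (B\<^sup>2)" .
  then have int: "integrable lebesgue (\<lambda>x. (cmod (f x))\<^sup>2)"
    by (intro integrableI_nonneg) (auto simp: le_less_trans[OF _ ennreal_less_top])
  then show "f \<in> L2_fun" by (simp add: L2_fun_def)
  have "ennreal ((L2_norm f)\<^sup>2) \<le> ennreal (B\<^sup>2)"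
    using le by (simp add: nn_integral_eq_integral[OF int] L2_norm_square)
  then show "L2_norm f \<le> B"
    by (intro power2_le_imp_le[OF _ B]) simp
qed

text \<open>The squared increments \<open>d k\<close> have integral at most
  \<open>(1/4) ^ k\<close>, which leaves room for a weight \<open>2 ^ k\<close>: the weighted sum
  still has a finite integral, so it is finite almost everywhere. At such a point the increments are
  eventually below \<open>(1 / sqrt 2) ^ k\<close>, and the telescoping series converges
  geometrically.\<close>

lemma L2_rapid_convergence:
  fixes G :: "nat \<Rightarrow> real ^ 'n \<Rightarrow> complex"
  assumes G: "\<And>k. G k \<in> L2_fun"
    and rapid: "\<And>k. L2_norm (\<lambda>x. G (Suc k) x - G k x) \<le> (1/2) ^ k"
  shows "AE x in lebesgue. convergent (\<lambda>k. G k x)"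
proof -
  have [measurable]: "G k \<in> borel_measurable lebesgue" for k by (rule L2_fun_measurable[OF G])
  define d where "d k x = (cmod (G (Suc k) x - G k x))\<^sup>2" for k x
  have d_int: "integrable lebesgue (d k)" for k
    unfolding d_def by (intro L2_fun_integrable L2_fun_diff G)
  have [measurable]: "d k \<in> borel_measurable lebesgue" for k
    unfolding d_def by measurable
  have d_nonneg: "0 \<le> d k x" for k x by (simp add: d_def)
  have d_le: "integral\<^sup>L lebesgue (d k) \<le> (1/4) ^ k" for k
  proof -
    have "integral\<^sup>L lebesgue (d k) = (L2_norm (\<lambda>x. G (Suc k) x - G k x))\<^sup>2"
      by (simp add: L2_norm_square d_def[abs_def])
    also have "\<dots> \<le> ((1/2) ^ k)\<^sup>2" by (intro power_mono rapid L2_norm_nonneg)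
    also have "\<dots> = ((1/2)\<^sup>2) ^ k"
      by (simp only: mult.commute flip: power_mult)
    also have "\<dots> = (1/4) ^ k" by (simp add: power_divide)
    finally show ?thesis .
  qed
  have "(\<integral>\<^sup>+x. (\<Sum>k. ennreal (2 ^ k * d k x)) \<partial>lebesgue)
      = (\<Sum>k. \<integral>\<^sup>+x. ennreal (2 ^ k * d k x) \<partial>lebesgue)"
    by (rule nn_integral_suminf) auto
  also have "\<dots> \<le> (\<Sum>k. ennreal ((1/2) ^ k))"
  proof (rule suminf_le)
    fix k
    have "(\<integral>\<^sup>+x. ennreal (2 ^ k * d k x) \<partial>lebesgue) = ennreal (2 ^ k * integral\<^sup>L lebesgue (d k))"
      using d_int[of k] d_nonneg by (subst nn_integral_eq_integral) auto
    also have "\<dots> \<le> ennreal (2 ^ k * (1/4) ^ k)"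
      by (intro ennreal_leI mult_left_mono d_le) auto
    also have "2 ^ k * (1/4) ^ k = ((1/2) ^ k :: real)"
      by (simp flip: power_mult_distrib)
    finally show "(\<integral>\<^sup>+x. ennreal (2 ^ k * d k x) \<partial>lebesgue) \<le> ennreal ((1/2) ^ k)" .
  qed auto
  also have "\<dots> = ennreal (\<Sum>k. (1/2) ^ k)"
    by (rule suminf_ennreal2) auto
  finally have "(\<integral>\<^sup>+x. (\<Sum>k. ennreal (2 ^ k * d k x)) \<partial>lebesgue) \<noteq> \<infinity>"
    by (auto simp: top_unique)
  then have "AE x in lebesgue. (\<Sum>k. ennreal (2 ^ k * d k x)) \<noteq> \<infinity>"
    by (intro nn_integral_PInf_AE) auto
  then show ?thesis
  proof eventually_elim
    fix x assume fin: "(\<Sum>k. ennreal (2 ^ k * d k x)) \<noteq> \<infinity>"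
    have "summable (\<lambda>k. 2 ^ k * d k x)"
      by (rule summable_suminf_not_top) (use fin in \<open>auto simp: d_def\<close>)
    then have "(\<lambda>k. 2 ^ k * d k x) \<longlonglongrightarrow> 0" by (rule summable_LIMSEQ_zero)
    then have "\<forall>\<^sub>F k in sequentially. 2 ^ k * d k x < 1" by (rule order_tendstoD) simp
    then obtain N where N: "\<And>k. k \<ge> N \<Longrightarrow> 2 ^ k * d k x < 1"
      by (auto simp: eventually_sequentially)
    have "summable (\<lambda>k. G (Suc k) x - G k x)"
    proof (rule summable_comparison_test[of _ "\<lambda>k. (1 / sqrt 2) ^ k"])
      show "summable (\<lambda>k. (1 / sqrt 2) ^ k)" by (rule summable_geometric) simp
      show "\<exists>N. \<forall>k\<ge>N. norm (G (Suc k) x - G k x) \<le> (1 / sqrt 2) ^ k"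
      proof (intro exI allI impI, rule power2_le_imp_le)
        fix k assume "k \<ge> N"
        have "((1 / sqrt 2) ^ k)\<^sup>2 = (((1 / sqrt 2)\<^sup>2) ^ k)"
          by (simp only: mult.commute flip: power_mult)
        also have "\<dots> = (1/2) ^ k" by (simp add: power_divide)
        finally show "(norm (G (Suc k) x - G k x))\<^sup>2 \<le> ((1 / sqrt 2) ^ k)\<^sup>2"
          using N[OF \<open>k \<ge> N\<close>] by (simp add: d_def power_divide field_simps)
      qed auto
    qed
    then show "convergent (\<lambda>k. G k x)"
      by (simp add: summable_iff_convergent convergent_diff_const_right_iff
          sum_lessThan_telescope[where f = "\<lambda>k. G k x"])
  qed
qed

theorem Riesz_Fischer:
  fixes F :: "nat \<Rightarrow> real ^ 'n \<Rightarrow> complex"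
  assumes "L2_Cauchy F"
  obtains f where "L2_tendsto F f"
proof -
  have F: "F m \<in> L2_fun" for m using assms by (simp add: L2_Cauchy_def)
  have [measurable]: "F k \<in> borel_measurable lebesgue" for k by (rule L2_fun_measurable[OF F])
  have "\<exists>N. \<forall>m\<ge>N. \<forall>l\<ge>N. L2_norm (\<lambda>x. F m x - F l x) < (1/2) ^ k" for k :: nat
    using assms unfolding L2_Cauchy_def by (meson half_gt_zero_iff zero_less_one zero_less_power)
  then obtain N where N: "\<And>k m l. m \<ge> N k \<Longrightarrow> l \<ge> N k \<Longrightarrow> L2_norm (\<lambda>x. F m x - F l x) < (1/2) ^ k"
    by metis
  \<comment> \<open>Adding all \<open>N i\<close> with \<open>i \<le> k\<close> makes both
    \<open>r k\<close> and \<open>r (Suc k)\<close> at least \<open>N k\<close>, so consecutive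
    members differ by less than \<open>(1/2) ^ k\<close>; the summand k makes the indices tend to
    infinity.\<close>
  define r where "r k = k + (\<Sum>i\<le>k. N i)" for k
  have r: "r k \<ge> N k" "r (Suc k) \<ge> N k" "r k \<ge> k" for k
    using member_le_sum[of k "{..k}" N] by (auto simp: r_def)
  have "AE x in lebesgue. convergent (\<lambda>k. F (r k) x)"
    by (rule L2_rapid_convergence) (use F N r in \<open>auto intro!: less_imp_le\<close>)
  then have conv: "AE x in lebesgue. (\<lambda>k. F (r k) x) \<longlonglongrightarrow> lim (\<lambda>k. F (r k) x)"
    by eventually_elim (simp add: convergent_LIMSEQ_iff)
  \<comment> \<open>\<open>lim\<close> is total; its value at points of divergence is unspecified,
    but these form a null set.\<close>
  define f where "f x = lim (\<lambda>k. F (r k) x)" for x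
  have f [measurable]: "f \<in> borel_measurable lebesgue"
    unfolding f_def by (rule borel_measurable_lim_metric) auto
  \<comment> \<open>Here m is fixed and the subsequence runs to its limit: Fatou turns the Cauchy
    bound into a bound for the distance to f. This handles the full sequence and not only the
    subsequence.\<close>
  have close: "(\<lambda>x. F m x - f x) \<in> L2_fun \<and> L2_norm (\<lambda>x. F m x - f x) \<le> (1/2) ^ k"
    if "m \<ge> N k" for m k
  proof -
    have *: "AE x in lebesgue. (\<lambda>j. F m x - F (r j) x) \<longlonglongrightarrow> F m x - f x"
      using conv unfolding f_def by eventually_elim (intro tendsto_intros)
    have **: "\<forall>\<^sub>F j in sequentially. L2_norm (\<lambda>x. F m x - F (r j) x) \<le> (1/2) ^ k"
      using eventually_ge_at_top[of "N k"]
    proof eventually_elim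
      case (elim j)
      then show ?case using N[OF that, of "r j"] r(3)[of j] by simp
    qed
    show ?thesis
      using L2_Fatou[OF L2_fun_diff[OF F F] _ * **] by auto
  qed
  \<comment> \<open>Write f as F m - (F m - f) with m = N 0; both terms are
    square-integrable.\<close>
  have "f \<in> L2_fun"
    using L2_fun_diff[OF F[of "N 0"] conjunct1[OF close[OF order_refl[of "N 0"]]]] by simp
  moreover have "(\<lambda>m. L2_norm (\<lambda>x. F m x - f x)) \<longlonglongrightarrow> 0"
  proof (rule LIMSEQ_I)
    fix e :: real assume "e > 0"
    then obtain k :: nat where k: "(1/2) ^ k < e" using real_arch_pow_inv[of e "1/2"] by auto
    have "\<forall>m\<ge>N k. norm (L2_norm (\<lambda>x. F m x - f x) - 0) < e"
      using close k by (auto simp: L2_norm_nonneg intro: le_less_trans)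
    then show "\<exists>M. \<forall>m\<ge>M. norm (L2_norm (\<lambda>x. F m x - f x) - 0) < e" by blast
  qed
  ultimately show ?thesis using that[of f] F by (simp add: L2_tendsto_def)
qed

section \<open>Continuous functions of compact support\<close>

lemma tendsto_0_if_le:
  fixes a b :: "nat \<Rightarrow> real"
  assumes "\<And>j. 0 \<le> a j" "\<And>j. a j \<le> b j" "b \<longlonglongrightarrow> 0"
  shows "a \<longlonglongrightarrow> 0"
  by (rule tendsto_sandwich[OF always_eventually always_eventually tendsto_const assms(3)])
    (use assms in auto)

lemma integrable_continuous_compact_support:
  fixes g :: "'a::euclidean_space \<Rightarrow> 'b::{banach, second_countable_topology}"
  assumes "continuous_on UNIV g" and "\<And>x. norm x > R \<Longrightarrow> g x = 0"
  shows "integrable lborel g"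
proof -
  have "integrable lborel (\<lambda>x. indicator (cball 0 R) x *\<^sub>R g x)"
    by (rule borel_integrable_compact) (use assms(1) in \<open>auto intro: continuous_on_subset\<close>)
  also have "(\<lambda>x. indicator (cball 0 R) x *\<^sub>R g x) = g"
    using assms(2) by (auto simp: fun_eq_iff indicator_def)
  finally show ?thesis .
qed

definition compact_support_cont :: "(real ^ 'n \<Rightarrow> complex) set" where
  "compact_support_cont = {g. continuous_on UNIV g \<and> (\<exists>R. \<forall>x. norm x > R \<longrightarrow> g x = 0)}"

lemma
  assumes "g \<in> compact_support_cont"
  shows compact_support_cont_continuous: "continuous_on UNIV g"
    and compact_support_cont_measurable: "g \<in> borel_measurable borel"
    and compact_support_cont_integrable_lborel: "integrable lborel g"
    and compact_support_cont_integrable: "integrable lebesgue g"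
    and compact_support_cont_L2: "g \<in> L2_fun"
    and compact_support_cont_bounded: "\<exists>B. \<forall>x. cmod (g x) \<le> B"
proof -
  obtain R where R: "\<And>x. norm x > R \<Longrightarrow> g x = 0" and cont: "continuous_on UNIV g"
    using assms by (auto simp: compact_support_cont_def)
  show "continuous_on UNIV g" by fact
  show meas [measurable]: "g \<in> borel_measurable borel"
    by (rule borel_measurable_continuous_onI[OF cont])
  show int: "integrable lborel g"
    by (rule integrable_continuous_compact_support[OF cont R])
  then show "integrable lebesgue g"
    by (subst integrable_completion) auto
  have "integrable lborel (\<lambda>x. (cmod (g x))\<^sup>2)"
    by (rule integrable_continuous_compact_support[where R = R])
      (auto intro!: continuous_intros cont simp: R)
  then have "integrable lebesgue (\<lambda>x. (cmod (g x))\<^sup>2)"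
    by (subst integrable_completion) auto
  then show "g \<in> L2_fun"
    by (simp add: L2_fun_def measurable_completion)
  have "compact (g ` cball 0 R)"
    by (rule compact_continuous_image) (auto intro: continuous_on_subset[OF cont])
  then obtain B where B: "\<forall>y\<in>g ` cball 0 R. cmod y \<le> B"
    using compact_imp_bounded bounded_iff by blast
  have "cmod (g x) \<le> max B 0" for x
    using B R[of x] by (cases "norm x \<le> R") (auto simp: le_max_iff_disj)
  then show "\<exists>B. \<forall>x. cmod (g x) \<le> B" by blast
qed

text \<open>Continuous functions converging to \<open>f\<close> almost everywhere are made to converge dominatedly by
  clipping their values to a disc and multiplying with a cut-off function.\<close>

lemma bounded_support_approx:
  fixes f :: "real ^ 'n \<Rightarrow> complex"
  assumes f [measurable]: "f \<in> borel_measurable lebesgue"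
    and B: "\<And>x. cmod (f x) \<le> B" and R: "\<And>x. norm x > R \<Longrightarrow> f x = 0" and "e > 0"
  obtains g where "g \<in> compact_support_cont" "L2_norm (\<lambda>x. f x - g x) < e"
    "(LINT x|lebesgue. cmod (f x - g x)) < e"
proof -
  have "f measurable_on UNIV"
    by (rule lebesgue_measurable_imp_measurable_on) auto
  then obtain N g where N: "negligible N" and g: "\<And>n. continuous_on UNIV (g n)"
    and lim: "\<And>x. x \<notin> N \<Longrightarrow> (\<lambda>n. g n x) \<longlonglongrightarrow> f x"
    unfolding measurable_on_def by auto
  have B0: "B \<ge> 0" using B[of 0] norm_ge_zero order_trans by blast
  define clip where "clip = closest_point (cball (0::complex) B)"
  have clip_cont: "continuous_on S clip" for S
    unfolding clip_def by (rule continuous_on_closest_point) (use B0 in auto)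
  have clip_le: "cmod (clip z) \<le> B" for z
    using closest_point_in_set[of "cball (0::complex) B" z] B0 by (simp add: clip_def)
  have clip_f: "clip (f x) = f x" for x
    unfolding clip_def by (rule closest_point_self) (use B in auto)
  define chi where "chi x = max 0 (min 1 (R + 1 - norm x))" for x :: "real ^ 'n"
  have chi_le: "0 \<le> chi x" "chi x \<le> 1" for x by (auto simp: chi_def)
  have chi_f: "of_real (chi x) * f x = f x" for x
    using R[of x] by (cases "norm x \<le> R") (auto simp: chi_def)
  define h where "h n x = of_real (chi x) * clip (g n x)" for n x
  have h_cont: "continuous_on UNIV (h n)" for n
    unfolding h_def chi_def
    by (intro continuous_intros continuous_on_compose2[OF clip_cont[of UNIV] g]) auto
  have h_supp: "h n x = 0" if "norm x > R + 1" for n x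
    using that by (simp add: h_def chi_def)
  have h_in: "h n \<in> compact_support_cont" for n
    using h_cont h_supp unfolding compact_support_cont_def by blast
  have [measurable]: "h n \<in> borel_measurable lebesgue" for n
    using L2_fun_measurable[OF compact_support_cont_L2[OF h_in]] .
  have h_le: "cmod (h n x) \<le> B" for n x
    using mult_mono[OF chi_le(2) clip_le[of "g n x"]] chi_le(1)[of x]
    by (simp add: h_def norm_mult)
  have h_lim: "AE x in lebesgue. (\<lambda>n. h n x) \<longlonglongrightarrow> f x"
  proof -
    have "AE x in lebesgue. x \<notin> N"
      using N by (simp add: AE_not_in negligible_iff_null_sets)
    then show ?thesis
    proof eventually_elim
      fix x assume "x \<notin> N"
      then have "(\<lambda>n. clip (g n x)) \<longlonglongrightarrow> clip (f x)"
        by (intro continuous_on_tendsto_compose[OF clip_cont[of UNIV] lim]) auto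
      then have "(\<lambda>n. h n x) \<longlonglongrightarrow> of_real (chi x) * clip (f x)"
        unfolding h_def by (intro tendsto_intros)
      then show "(\<lambda>n. h n x) \<longlonglongrightarrow> f x" by (simp add: clip_f chi_f)
    qed
  qed
  have supp: "f x - h n x = 0" if "norm x > R + 1" for n x
    using that R[of x] h_supp[of x n] by simp
  have diff_le: "cmod (f x - h n x) \<le> 2 * B" for n x
    using norm_triangle_ineq4[of "f x" "h n x"] B[of x] h_le[of n x] by linarith
  \<comment> \<open>The ball of radius R + 1 contains the supports of f and of every
    \<open>h n\<close>, so \<open>?w\<close> with C = 2B dominates the differences and with C =
    (2B)^2 their squares.\<close>
  let ?w = "\<lambda>C x. C * indicator (cball 0 (R + 1)) x :: real"
  have w: "integrable lebesgue (?w C)" for C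
    by (intro integrable_mult_right integrable_real_indicator)
      (auto simp: emeasure_bounded_finite[OF bounded_cball, unfolded infinity_ennreal_def])
  have le1: "cmod (f x - h n x) \<le> ?w (2 * B) x" for n x
    using diff_le[of x n] supp[of x n] by (cases "norm x \<le> R + 1") auto
  have le2: "(cmod (f x - h n x))\<^sup>2 \<le> ?w ((2 * B)\<^sup>2) x" for n x
    using power_mono[OF diff_le[of x n], of 2] supp[of x n] by (cases "norm x \<le> R + 1") auto
  have "(\<lambda>n. LINT x|lebesgue. (cmod (f x - h n x))\<^sup>2) \<longlonglongrightarrow> (LINT x::real^'n|lebesgue. 0)"
  proof (rule integral_dominated_convergence[OF _ _ w])
    show "AE x in lebesgue. (\<lambda>n. (cmod (f x - h n x))\<^sup>2) \<longlonglongrightarrow> 0"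
      using h_lim by eventually_elim (auto intro!: tendsto_eq_intros)
    show "AE x in lebesgue. norm ((cmod (f x - h n x))\<^sup>2) \<le> ?w ((2 * B)\<^sup>2) x" for n
      using le2 by auto
  qed auto
  then have "(\<lambda>n. sqrt (LINT x|lebesgue. (cmod (f x - h n x))\<^sup>2)) \<longlonglongrightarrow> sqrt 0"
    by (intro tendsto_real_sqrt) simp
  then have L2: "\<forall>\<^sub>F n in sequentially. L2_norm (\<lambda>x. f x - h n x) < e"
    using \<open>e > 0\<close> by (intro order_tendstoD(2)[where y = 0]) (auto simp: L2_norm_def)
  have "(\<lambda>n. LINT x|lebesgue. cmod (f x - h n x)) \<longlonglongrightarrow> (LINT x::real^'n|lebesgue. 0)"
  proof (rule integral_dominated_convergence[OF _ _ w])
    show "AE x in lebesgue. (\<lambda>n. cmod (f x - h n x)) \<longlonglongrightarrow> 0"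
      using h_lim by eventually_elim (auto intro!: tendsto_eq_intros)
    show "AE x in lebesgue. norm (cmod (f x - h n x)) \<le> ?w (2 * B) x" for n
      using le1 by auto
  qed auto
  then have L1: "\<forall>\<^sub>F n in sequentially. (LINT x|lebesgue. cmod (f x - h n x)) < e"
    using \<open>e > 0\<close> by (intro order_tendstoD(2)[where y = 0]) auto
  obtain n where "L2_norm (\<lambda>x. f x - h n x) < e" "(LINT x|lebesgue. cmod (f x - h n x)) < e"
    using eventually_happens[OF eventually_conj[OF L2 L1]] by auto
  then show ?thesis using that h_in by blast
qed

text \<open>At each point the truncation agrees with f once the level exceeds both the norm of the
  point and the modulus of the value there.\<close>

lemma truncation_tendsto:
  fixes f :: "real ^ 'n \<Rightarrow> complex" and j :: nat
  defines "T \<equiv> \<lambda>j x. if norm x \<le> real j \<and> cmod (f x) \<le> real j then f x else 0"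
  shows "(\<lambda>j. T j x) \<longlonglongrightarrow> f x"
proof (rule tendsto_eventually)
  obtain M :: nat where M: "max (norm x) (cmod (f x)) \<le> real M"
    using real_arch_simple by blast
  show "\<forall>\<^sub>F j in sequentially. T j x = f x"
    using eventually_ge_at_top[of M] by eventually_elim (use M in \<open>auto simp: T_def\<close>)
qed

text \<open>One sequence has to serve both norms when f is integrable: L1 convergence forces the
  transforms to converge pointwise, while L2 convergence controls their norms. The function is
  truncated in domain and range, and each truncation is then approximated in both norms at
  once.\<close>

lemma compact_support_cont_dense:
  fixes f :: "real ^ 'n \<Rightarrow> complex"
  assumes f: "f \<in> L2_fun"
  obtains G where "\<And>j. G j \<in> compact_support_cont" "L2_tendsto G f"
    "integrable lebesgue f \<Longrightarrow> (\<lambda>j. LINT x|lebesgue. cmod (f x - G j x)) \<longlonglongrightarrow> 0"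
proof -
  have f_meas [measurable]: "f \<in> borel_measurable lebesgue" by (rule L2_fun_measurable[OF f])
  define T where "T j x = (if norm x \<le> real j \<and> cmod (f x) \<le> real j then f x else 0)" for j x
  have [measurable]: "(\<lambda>x::real^'n. x) \<in> borel_measurable lebesgue"
    by (rule measurable_completion) simp
  have T_meas [measurable]: "T j \<in> borel_measurable lebesgue" for j
    unfolding T_def by measurable
  \<comment> \<open>\<open>Suc j\<close> keeps the tolerance positive at \<open>j = 0\<close>, where
    \<open>1 / real j\<close> would be 0.\<close>
  have "\<exists>g. g \<in> compact_support_cont \<and> L2_norm (\<lambda>x. T j x - g x) < 1 / real (Suc j) \<and>
      (LINT x|lebesgue. cmod (T j x - g x)) < 1 / real (Suc j)" for j
    by (rule bounded_support_approx[of "T j" "real j" "real j" "1 / real (Suc j)"])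
      (auto simp: T_def T_meas[unfolded T_def[abs_def]])
  then obtain G where G: "\<And>j. G j \<in> compact_support_cont"
    and G2: "\<And>j. L2_norm (\<lambda>x. T j x - G j x) < 1 / real (Suc j)"
    and G1: "\<And>j. (LINT x|lebesgue. cmod (T j x - G j x)) < 1 / real (Suc j)"
    by metis
  have T_lim: "(\<lambda>j. cmod (f x - T j x)) \<longlonglongrightarrow> 0" for x
  proof -
    have "(\<lambda>j. T j x) \<longlonglongrightarrow> f x"
      using truncation_tendsto[where f = f and x = x] by (simp add: T_def)
    then have "(\<lambda>j. cmod (f x - T j x)) \<longlonglongrightarrow> cmod (f x - f x)"
      by (intro tendsto_intros)
    then show ?thesis by simp
  qed
  have T_diff: "cmod (f x - T j x) \<le> cmod (f x)" for j x by (simp add: T_def)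
  have T_L2: "T j \<in> L2_fun" for j
    by (rule L2_fun_dominated[OF T_meas L2_fun_integrable[OF f]]) (simp add: T_def)
  have G_L2: "G j \<in> L2_fun" for j by (rule compact_support_cont_L2[OF G])
  have inv: "(\<lambda>j. 1 / real (Suc j)) \<longlonglongrightarrow> 0" by (rule LIMSEQ_Suc[OF lim_1_over_n])
  have "(\<lambda>j. LINT x|lebesgue. (cmod (f x - T j x))\<^sup>2) \<longlonglongrightarrow> (LINT x::real^'n|lebesgue. 0)"
  proof (rule integral_dominated_convergence[OF _ _ L2_fun_integrable[OF f]])
    show "AE x in lebesgue. (\<lambda>j. (cmod (f x - T j x))\<^sup>2) \<longlonglongrightarrow> 0"
      using T_lim by simp
    show "AE x in lebesgue. norm ((cmod (f x - T j x))\<^sup>2) \<le> (cmod (f x))\<^sup>2" for j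
      using T_diff by (auto intro!: power_mono)
  qed auto
  then have "(\<lambda>j. L2_norm (\<lambda>x. f x - T j x)) \<longlonglongrightarrow> sqrt 0"
    unfolding L2_norm_def by (intro tendsto_real_sqrt) simp
  then have "(\<lambda>j. L2_norm (\<lambda>x. f x - T j x) + 1 / real (Suc j)) \<longlonglongrightarrow> sqrt 0 + 0"
    by (rule tendsto_add[OF _ inv])
  then have L2_lim: "(\<lambda>j. L2_norm (\<lambda>x. f x - T j x) + 1 / real (Suc j)) \<longlonglongrightarrow> 0"
    by simp
  have L2_le: "L2_norm (\<lambda>x. G j x - f x) \<le> L2_norm (\<lambda>x. f x - T j x) + 1 / real (Suc j)" for j
    using L2_norm_triangle_diff[OF f T_L2[of j] G_L2[of j]] G2[of j]
    by (simp add: L2_norm_minus_commute[of f "G j"])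
  have "(\<lambda>j. L2_norm (\<lambda>x. G j x - f x)) \<longlonglongrightarrow> 0"
    by (rule tendsto_0_if_le[OF L2_norm_nonneg L2_le L2_lim])
  then have "L2_tendsto G f" by (simp add: L2_tendsto_def G_L2 f)
  moreover have "(\<lambda>j. LINT x|lebesgue. cmod (f x - G j x)) \<longlonglongrightarrow> 0" if int: "integrable lebesgue f"
  proof -
    have T_int: "integrable lebesgue (T j)" for j
      by (rule Bochner_Integration.integrable_bound[OF int]) (auto simp: T_def[abs_def])
    have G_int: "integrable lebesgue (G j)" for j by (rule compact_support_cont_integrable[OF G])
    have "(\<lambda>j. LINT x|lebesgue. cmod (f x - T j x)) \<longlonglongrightarrow> (LINT x::real^'n|lebesgue. 0)"
    proof (rule integral_dominated_convergence[OF _ _ integrable_norm[OF int]])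
      show "AE x in lebesgue. (\<lambda>j. cmod (f x - T j x)) \<longlonglongrightarrow> 0"
        using T_lim by simp
      show "AE x in lebesgue. norm (cmod (f x - T j x)) \<le> cmod (f x)" for j
        using T_diff by auto
    qed auto
    from tendsto_add[OF this inv]
    have lim: "(\<lambda>j. (LINT x|lebesgue. cmod (f x - T j x)) + 1 / real (Suc j)) \<longlonglongrightarrow> 0"
      by simp
    have "(LINT x|lebesgue. cmod (f x - G j x))
        \<le> (LINT x|lebesgue. cmod (f x - T j x) + cmod (T j x - G j x))" for j
    proof (rule integral_mono)
      show "cmod (f x - G j x) \<le> cmod (f x - T j x) + cmod (T j x - G j x)" for x
        using norm_triangle_ineq[of "f x - T j x" "T j x - G j x"] by simp
    qed (intro integrable_norm Bochner_Integration.integrable_add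
        Bochner_Integration.integrable_diff int T_int G_int)+
    also have "(LINT x|lebesgue. cmod (f x - T j x) + cmod (T j x - G j x))
        = (LINT x|lebesgue. cmod (f x - T j x)) + (LINT x|lebesgue. cmod (T j x - G j x))" for j
      by (intro Bochner_Integration.integral_add integrable_norm
          Bochner_Integration.integrable_diff int T_int G_int)
    finally have L1_le: "(LINT x|lebesgue. cmod (f x - G j x))
        \<le> (LINT x|lebesgue. cmod (f x - T j x)) + 1 / real (Suc j)" for j
      using G1[of j] by (meson add_left_mono less_imp_le order_trans)
    show ?thesis
      by (rule tendsto_0_if_le[OF _ L1_le lim]) simp
  qed
  ultimately show ?thesis using that G by blast
qed

section \<open>Gaussians\<close>

definition character :: "real \<Rightarrow> complex" where
  "character t = exp (2 * complex_of_real pi * \<i> * complex_of_real t)"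

lemma character_add: "character (s + t) = character s * character t"
  by (simp add: character_def distrib_left exp_add)

lemma character_0 [simp]: "character 0 = 1"
  by (simp add: character_def)

lemma cnj_character: "cnj (character t) = character (- t)"
  by (simp add: character_def exp_cnj)

lemma cmod_character [simp]: "cmod (character t) = 1"
  by (simp add: character_def norm_exp_eq_Re)

lemma continuous_on_character [continuous_intros]:
  "continuous_on S f \<Longrightarrow> continuous_on S (\<lambda>x. character (f x))"
  unfolding character_def by (intro continuous_intros)

lemma borel_measurable_character [measurable]: "character \<in> borel_measurable borel"
  by (rule borel_measurable_continuous_onI) (intro continuous_intros)

lemma fourier_L1_character: "fourier_L1 f k = (LINT x|lebesgue. f x * character (- (k \<bullet> x)))"
  by (simp add: fourier_L1_def character_def)

section \<open>Dilations, translations and products under Lebesgue measure\<close>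

lemma lborel_integral_scaleR:
  fixes f :: "'a::euclidean_space \<Rightarrow> 'b::{banach, second_countable_topology}"
  assumes [measurable]: "f \<in> borel_measurable borel" and "c \<noteq> 0"
  shows "(LINT x|lborel. f x) = \<bar>c\<bar> ^ DIM('a) *\<^sub>R (LINT x|lborel. f (c *\<^sub>R x))"
proof -
  have "(LINT x|lborel. f x) =
      (LINT x|density (distr lborel borel (\<lambda>x. 0 + c *\<^sub>R x)) (\<lambda>_. ennreal (\<bar>c\<bar> ^ DIM('a))). f x)"
    using lborel_affine[OF \<open>c \<noteq> 0\<close>, of "0::'a"] by simp
  also have "\<dots> = \<bar>c\<bar> ^ DIM('a) *\<^sub>R (LINT x|lborel. f (c *\<^sub>R x))"
    by (subst integral_density) (auto simp: integral_distr)
  finally show ?thesis .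
qed

lemma lborel_integrable_scaleR:
  fixes f :: "'a::euclidean_space \<Rightarrow> 'b::{banach, second_countable_topology}"
  assumes int: "integrable lborel f" and "c \<noteq> 0"
  shows "integrable lborel (\<lambda>x. f (c *\<^sub>R x))"
proof -
  have [measurable]: "f \<in> borel_measurable borel" using int by auto
  have "integrable (density (distr lborel borel (\<lambda>x. 0 + c *\<^sub>R x)) (\<lambda>_. ennreal (\<bar>c\<bar> ^ DIM('a)))) f"
    using int lborel_affine[OF \<open>c \<noteq> 0\<close>, of "0::'a"] by simp
  then have "integrable (distr lborel borel (\<lambda>x. 0 + c *\<^sub>R x)) (\<lambda>x. \<bar>c\<bar> ^ DIM('a) *\<^sub>R f x)"
    by (subst (asm) integrable_density) auto
  then have "integrable lborel (\<lambda>x. \<bar>c\<bar> ^ DIM('a) *\<^sub>R f (c *\<^sub>R x))"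
    by (subst (asm) integrable_distr_eq) auto
  from integrable_scaleR_right[OF this, of "inverse (\<bar>c\<bar> ^ DIM('a))"]
  show ?thesis using \<open>c \<noteq> 0\<close> by simp
qed

lemma
  fixes f :: "'a::euclidean_space \<Rightarrow> 'b::{banach, second_countable_topology}"
  assumes [measurable]: "f \<in> borel_measurable borel"
  shows lborel_integral_shift: "(LINT x|lborel. f (x + c)) = (LINT x|lborel. f x)"
    and lborel_integrable_shift: "integrable lborel (\<lambda>x. f (x + c)) \<longleftrightarrow> integrable lborel f"
proof -
  show "(LINT x|lborel. f (x + c)) = (LINT x|lborel. f x)"
    using integral_distr[of "(+) c" lborel borel f] by (simp add: lborel_distr_plus add.commute)
  show "integrable lborel (\<lambda>x. f (x + c)) \<longleftrightarrow> integrable lborel f"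
    using integrable_distr_eq[of "(+) c" lborel borel f] by (simp add: lborel_distr_plus add.commute)
qed

text \<open>\<open>lborel\<close> is the image of the product of one-dimensional Lebesgue measures
  under the coordinate map, so Fubini for finite products applies. This reduces Gaussian integrals
  to dimension one.\<close>

lemma
  fixes F :: "'a::euclidean_space \<Rightarrow> real \<Rightarrow> 'b::{real_normed_field, banach, second_countable_topology}"
  assumes "\<And>b. b \<in> Basis \<Longrightarrow> integrable lborel (F b)"
  shows integrable_lborel_prod: "integrable lborel (\<lambda>x::'a. \<Prod>b\<in>Basis. F b (x \<bullet> b))"
    and integral_lborel_prod: "(LINT x::'a|lborel. (\<Prod>b\<in>Basis. F b (x \<bullet> b))) = (\<Prod>b\<in>Basis. (LINT t|lborel. F b t))"
proof -
  interpret product_sigma_finite "\<lambda>_::'a. lborel :: real measure" ..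
  have [measurable]: "F b \<in> borel_measurable borel" if "b \<in> Basis" for b
    using assms[OF that] by auto
  have meas: "(\<lambda>x::'a. \<Prod>b\<in>Basis. F b (x \<bullet> b)) \<in> borel_measurable borel"
    by measurable
  have sum: "(\<lambda>f. \<Sum>b\<in>Basis. f b *\<^sub>R b :: 'a) \<in> (\<Pi>\<^sub>M b\<in>(Basis::'a set). lborel) \<rightarrow>\<^sub>M borel"
    by measurable
  have eq: "(\<Prod>b\<in>Basis. F b ((\<Sum>i\<in>Basis. f i *\<^sub>R i) \<bullet> b)) = (\<Prod>b\<in>Basis. F b (f b))" for f
    by (intro prod.cong refl) (simp add: inner_sum_left inner_Basis if_distrib sum.delta cong: if_cong)
  show "integrable lborel (\<lambda>x::'a. \<Prod>b\<in>Basis. F b (x \<bullet> b))"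
    unfolding lborel_eq[where 'a = 'a] integrable_distr_eq[OF sum meas] eq
    by (rule product_integrable_prod) (auto intro: assms)
  show "(LINT x::'a|lborel. (\<Prod>b\<in>Basis. F b (x \<bullet> b))) = (\<Prod>b\<in>Basis. (LINT t|lborel. F b t))"
    unfolding lborel_eq[where 'a = 'a] integral_distr[OF sum meas] eq
    by (rule product_integral_prod) (auto intro: assms)
qed

text \<open>The factor \<pi> in the exponent matches the 2\<pi> in the Fourier kernel: with it the
  Gaussian has integral 1 and is its own transform.\<close>

definition gauss :: "'a::real_normed_vector \<Rightarrow> real" where
  "gauss x = exp (- pi * (norm x)\<^sup>2)"

section \<open>The transform of the Gaussian\<close>

lemma gauss_real: "gauss (x::real) = std_normal_density (sqrt (2 * pi) * x) * sqrt (2 * pi)"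
  by (simp add: gauss_def std_normal_density_def power_mult_distrib)

lemma integrable_gauss_real: "integrable lborel (gauss :: real \<Rightarrow> real)"
proof -
  have "integrable lborel (\<lambda>x. std_normal_density (0 + sqrt (2 * pi) * x))"
    by (rule lborel_integrable_real_affine) auto
  then show ?thesis by (simp add: gauss_real[abs_def])
qed

lemma borel_measurable_gauss [measurable]: "gauss \<in> borel_measurable borel"
  unfolding gauss_def[abs_def] by measurable

lemma integrable_gauss_character_real:
  "integrable lborel (\<lambda>x::real. complex_of_real (gauss x) * character (- (k * x)))"
  by (rule Bochner_Integration.integrable_bound[OF integrable_gauss_real])
    (auto simp: norm_mult)

text \<open>The standard normal distribution has characteristic function exp(-t^2/2). Evaluating it
  at t = -sqrt(2\<pi>) k gives exp(-\<pi> k^2), and substituting sqrt(2\<pi>) x for x turns its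
  defining integral into the Fourier integral of \<open>gauss\<close>.\<close>

lemma fourier_gauss_real:
  "(LINT x|lborel. complex_of_real (gauss (x::real)) * character (- (k * x))) = gauss k"
proof -
  let ?t = "- (sqrt (2 * pi) * k)"
  have "complex_of_real (exp (- (?t\<^sup>2) / 2)) = char std_normal_distribution ?t"
    by (simp add: char_std_normal_distribution)
  also have "\<dots> = (LINT x|lborel. std_normal_density x *\<^sub>R iexp (?t * x))"
    unfolding char_def by (subst integral_density) auto
  also have "\<dots> = (LINT x|lborel. sqrt (2 * pi) *\<^sub>R
      (std_normal_density (0 + sqrt (2 * pi) * x) *\<^sub>R iexp (?t * (0 + sqrt (2 * pi) * x))))"
    by (subst lborel_integral_real_affine[where c = "sqrt (2 * pi)" and t = 0])
      (simp_all del: scaleR_scaleR)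
  also have "\<dots> = (LINT x|lborel. complex_of_real (gauss x) * character (- (k * x)))"
  proof (rule Bochner_Integration.integral_cong[OF refl])
    fix x
    have "?t * (0 + sqrt (2 * pi) * x) = - (2 * pi * (k * x))"
      by (simp add: algebra_simps)
    then have "iexp (?t * (0 + sqrt (2 * pi) * x)) = character (- (k * x))"
      by (simp only: character_def) (simp add: algebra_simps)
    then show "sqrt (2 * pi) *\<^sub>R (std_normal_density (0 + sqrt (2 * pi) * x) *\<^sub>R
        iexp (?t * (0 + sqrt (2 * pi) * x))) = complex_of_real (gauss x) * character (- (k * x))"
      by (simp only: gauss_real) (simp add: scaleR_conv_of_real mult_ac)
  qed
  finally show ?thesis by (simp add: gauss_def power_mult_distrib)
qed

lemma gauss_prod: "gauss (x::'a::euclidean_space) = (\<Prod>b\<in>Basis. gauss (x \<bullet> b))"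
proof -
  have "(norm x)\<^sup>2 = (\<Sum>b\<in>Basis. (x \<bullet> b)\<^sup>2)"
    unfolding power2_norm_eq_inner by (subst euclidean_inner) (simp add: power2_eq_square)
  then show ?thesis by (simp add: gauss_def sum_distrib_left exp_sum[symmetric] sum_negf)
qed

lemma character_inner_prod:
  "character (- (k \<bullet> x)) = (\<Prod>b\<in>Basis. character (- ((k \<bullet> b) * (x \<bullet> b))))"
  for k x :: "'a::euclidean_space"
  by (subst euclidean_inner) (simp add: character_def sum_distrib_left exp_sum[symmetric] sum_negf)

lemma
  fixes k :: "'a::euclidean_space"
  shows integrable_gauss_character:
      "integrable lborel (\<lambda>x::'a. complex_of_real (gauss x) * character (- (k \<bullet> x)))"
    and fourier_gauss:
      "(LINT x|lborel. complex_of_real (gauss x) * character (- (k \<bullet> x))) = gauss k"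
proof -
  have eq: "complex_of_real (gauss x) * character (- (k \<bullet> x)) =
      (\<Prod>b\<in>Basis. complex_of_real (gauss (x \<bullet> b)) * character (- ((k \<bullet> b) * (x \<bullet> b))))" for x
    by (simp add: gauss_prod[of x] character_inner_prod prod.distrib)
  show "integrable lborel (\<lambda>x::'a. complex_of_real (gauss x) * character (- (k \<bullet> x)))"
    unfolding eq by (rule integrable_lborel_prod[OF integrable_gauss_character_real])
  show "(LINT x|lborel. complex_of_real (gauss x) * character (- (k \<bullet> x))) = gauss k"
    unfolding eq
    by (subst integral_lborel_prod[OF integrable_gauss_character_real])
      (simp_all add: fourier_gauss_real gauss_prod[of k])
qed

lemma
  shows integrable_gauss: "integrable lborel (gauss :: 'a::euclidean_space \<Rightarrow> real)"
    and integral_gauss: "(LINT x|lborel. gauss (x::'a)) = 1"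
proof -
  show int: "integrable lborel (gauss :: 'a \<Rightarrow> real)"
    using integrable_norm[OF integrable_gauss_character[of "0::'a"]]
    by (simp add: gauss_def[abs_def])
  have "complex_of_real (LINT x|lborel. gauss (x::'a)) = of_real (gauss (0::'a))"
    using fourier_gauss[of "0::'a"] by simp
  then show "(LINT x|lborel. gauss (x::'a)) = 1"
    by (simp only: of_real_eq_iff) (simp add: gauss_def)
qed

section \<open>The Fourier transform on $L^1$\<close>

lemma borel_measurable_character_inner_lebesgue [measurable]:
  "(\<lambda>x::'a::euclidean_space. character (k \<bullet> x)) \<in> borel_measurable lebesgue"
  "(\<lambda>x::'a::euclidean_space. character (- (k \<bullet> x))) \<in> borel_measurable lebesgue"
  by (rule measurable_completion, simp)+

lemma integrable_mult_unimodular: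
  fixes f u :: "'a \<Rightarrow> complex"
  assumes "integrable M f" "u \<in> borel_measurable M" "\<And>x. cmod (u x) = 1"
  shows "integrable M (\<lambda>x. f x * u x)"
  by (rule Bochner_Integration.integrable_bound[OF assms(1)])
    (use assms in \<open>auto simp: norm_mult\<close>)

lemma integrable_mult_character:
  fixes f :: "real ^ 'n \<Rightarrow> complex"
  assumes "integrable lebesgue f"
  shows "integrable lebesgue (\<lambda>x. f x * character (k \<bullet> x))"
    and "integrable lebesgue (\<lambda>x. f x * character (- (k \<bullet> x)))"
  by (rule integrable_mult_unimodular[OF assms]; simp)+

lemma fourier_L1_lborel:
  assumes "f \<in> borel_measurable borel"
  shows "fourier_L1 f k = (LINT x|lborel. f x * character (- (k \<bullet> x)))"
  unfolding fourier_L1_character by (rule integral_completion) (use assms in simp)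

lemma fourier_L1_cong_AE:
  assumes [measurable]: "f \<in> borel_measurable lebesgue" and "AE x in lebesgue. f x = g x"
  shows "fourier_L1 f = fourier_L1 g"
proof
  fix k
  have [measurable]: "g \<in> borel_measurable lebesgue" by (rule borel_measurable_AE[OF assms])
  show "fourier_L1 f k = fourier_L1 g k"
    unfolding fourier_L1_character by (rule integral_cong_AE) (use assms(2) in auto)
qed

lemma cmod_fourier_L1_le: "cmod (fourier_L1 f k) \<le> (LINT x|lebesgue. cmod (f x))"
  unfolding fourier_L1_character
  by (rule order_trans[OF integral_norm_bound]) (simp add: norm_mult)

lemma fourier_L1_diff:
  assumes "integrable lebesgue f" "integrable lebesgue g"
  shows "fourier_L1 (\<lambda>x. f x - g x) k = fourier_L1 f k - fourier_L1 g k"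
  unfolding fourier_L1_character left_diff_distrib
  by (rule Bochner_Integration.integral_diff) (rule integrable_mult_character assms)+

lemma fourier_L1_add:
  assumes "integrable lebesgue f" "integrable lebesgue g"
  shows "fourier_L1 (\<lambda>x. f x + g x) k = fourier_L1 f k + fourier_L1 g k"
  unfolding fourier_L1_character distrib_right
  by (rule Bochner_Integration.integral_add) (rule integrable_mult_character assms)+

lemma fourier_L1_scale: "fourier_L1 (\<lambda>x. c * f x) k = c * fourier_L1 f k"
  by (simp add: fourier_L1_character mult.assoc)

text \<open>Dominated convergence along sequences, with |f| as majorant since the exponential is
  unimodular. Continuity also supplies the Borel measurability of the transform that later integrals
  rely on.\<close>

lemma continuous_fourier_L1:
  fixes f :: "real ^ 'n \<Rightarrow> complex"
  assumes f: "integrable lebesgue f"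
  shows "continuous_on UNIV (fourier_L1 f)"
  unfolding continuous_on_sequentially
proof (intro ballI allI impI)
  fix X :: "nat \<Rightarrow> real ^ 'n" and k
  assume "(\<forall>n. X n \<in> UNIV) \<and> X \<longlonglongrightarrow> k"
  then have X: "X \<longlonglongrightarrow> k" by simp
  have [measurable]: "f \<in> borel_measurable lebesgue" using f by auto
  show "(fourier_L1 f \<circ> X) \<longlonglongrightarrow> fourier_L1 f k"
    unfolding o_def fourier_L1_character
  proof (rule integral_dominated_convergence[OF _ _ integrable_norm[OF f]])
    show "AE x in lebesgue. (\<lambda>n. f x * character (- (X n \<bullet> x))) \<longlonglongrightarrow> f x * character (- (k \<bullet> x))"
    proof (rule AE_I2)
      fix x
      show "(\<lambda>n. f x * character (- (X n \<bullet> x))) \<longlonglongrightarrow> f x * character (- (k \<bullet> x))"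
        unfolding character_def by (intro tendsto_intros X)
    qed
  qed (auto simp: norm_mult)
qed

lemma borel_measurable_fourier_L1:
  "integrable lebesgue f \<Longrightarrow> fourier_L1 f \<in> borel_measurable borel"
  by (rule borel_measurable_continuous_onI[OF continuous_fourier_L1])

section \<open>The multiplication formula\<close>

lemma fourier_multiplication_lborel:
  fixes f g :: "real ^ 'n \<Rightarrow> complex"
  assumes f: "integrable lborel f" and g: "integrable lborel g"
  shows "(LINT k|lborel. fourier_L1 f k * g k) = (LINT x|lborel. f x * fourier_L1 g x)"
proof -
  have [measurable]: "f \<in> borel_measurable borel" "g \<in> borel_measurable borel"
    using f g by auto
  let ?F = "\<lambda>x k. f x * character (- (k \<bullet> x)) * g k"
  have meas: "case_prod ?F \<in> borel_measurable (lborel \<Otimes>\<^sub>M lborel)"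
    by measurable
  \<comment> \<open>The exponential has modulus 1, so integrability on the product space comes down
    to that of f(x) g(k), and Fubini may exchange the two integrals.\<close>
  have int: "integrable (lborel \<Otimes>\<^sub>M lborel) (case_prod ?F)"
  proof (rule lborel_pair.Fubini_integrable[OF meas])
    show "integrable lborel (\<lambda>x. LINT k|lborel. norm (case_prod ?F (x, k)))"
      using f by (simp add: norm_mult)
    have "integrable lborel (\<lambda>k. f x * (g k * character (- (k \<bullet> x))))" for x
      by (intro integrable_mult_right integrable_mult_unimodular g) auto
    then show "AE x in lborel. integrable lborel (\<lambda>k. case_prod ?F (x, k))"
      by (simp add: mult_ac)
  qed
  have "(LINT k|lborel. fourier_L1 f k * g k) = (LINT k|lborel. (LINT x|lborel. ?F x k))"
    by (simp add: fourier_L1_lborel)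
  also have "\<dots> = (LINT x|lborel. (LINT k|lborel. ?F x k))"
    by (rule lborel_pair.Fubini_integral[OF int])
  also have "\<dots> = (LINT x|lborel. f x * fourier_L1 g x)"
  proof (rule Bochner_Integration.integral_cong[OF refl])
    fix x
    have "(LINT k|lborel. ?F x k) = (LINT k|lborel. f x * (g k * character (- (x \<bullet> k))))"
      by (simp only: inner_commute mult_ac)
    then show "(LINT k|lborel. ?F x k) = f x * fourier_L1 g x"
      by (simp add: fourier_L1_lborel)
  qed
  finally show ?thesis .
qed

lemma lebesgue_measurable_borel_representative:
  fixes f :: "'a::euclidean_space \<Rightarrow> complex"
  assumes [measurable]: "f \<in> borel_measurable lebesgue"
  obtains f' where "f' \<in> borel_measurable borel" "AE x in lebesgue. f x = f' x"
proof -
  obtain r i where ri [measurable]: "r \<in> borel_measurable lborel" "i \<in> borel_measurable lborel"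
    and ae: "AE x in lborel. Re (f x) = r x" "AE x in lborel. Im (f x) = i x"
    using completion_ex_borel_measurable_real[of "\<lambda>x. Re (f x)" lborel]
      completion_ex_borel_measurable_real[of "\<lambda>x. Im (f x)" lborel] by auto
  show ?thesis
  proof (rule that[of "\<lambda>x. Complex (r x) (i x)"])
    show "(\<lambda>x. Complex (r x) (i x)) \<in> borel_measurable borel"
      using ri unfolding Complex_eq by measurable
    show "AE x in lebesgue. f x = Complex (r x) (i x)"
      using AE_completion[OF ae(1)] AE_completion[OF ae(2)]
      by eventually_elim (simp add: complex_eq_iff)
  qed
qed

text \<open>Fubini was applied to Borel functions. Replacing f and g by Borel functions that agree
  with them almost everywhere changes neither the integrals nor, at any point, the
  transforms.\<close>

lemma fourier_multiplication:
  fixes f g :: "real ^ 'n \<Rightarrow> complex"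
  assumes f: "integrable lebesgue f" and g: "integrable lebesgue g"
  shows "(LINT k|lebesgue. fourier_L1 f k * g k) = (LINT x|lebesgue. f x * fourier_L1 g x)"
proof -
  have [measurable]: "f \<in> borel_measurable lebesgue" "g \<in> borel_measurable lebesgue"
    using f g by auto
  obtain f' where f' [measurable]: "f' \<in> borel_measurable borel" and ff': "AE x in lebesgue. f x = f' x"
    by (rule lebesgue_measurable_borel_representative[of f]) auto
  obtain g' where g' [measurable]: "g' \<in> borel_measurable borel" and gg': "AE x in lebesgue. g x = g' x"
    by (rule lebesgue_measurable_borel_representative[of g]) auto
  have [measurable]: "f' \<in> borel_measurable lebesgue" "g' \<in> borel_measurable lebesgue"
    by (auto intro: measurable_completion)
  have "integrable lebesgue f'" "integrable lebesgue g'"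
    using integrable_cong_AE_imp[OF f _ ff'] integrable_cong_AE_imp[OF g _ gg'] by auto
  then have int: "integrable lborel f'" "integrable lborel g'"
    by (simp_all add: integrable_completion)
  have F: "fourier_L1 f = fourier_L1 f'" "fourier_L1 g = fourier_L1 g'"
    using ff' gg' by (auto intro: fourier_L1_cong_AE)
  have [measurable]: "fourier_L1 f' \<in> borel_measurable borel" "fourier_L1 g' \<in> borel_measurable borel"
    using borel_measurable_fourier_L1[OF f] borel_measurable_fourier_L1[OF g] F by auto
  then have [measurable]: "fourier_L1 f' \<in> borel_measurable lebesgue" "fourier_L1 g' \<in> borel_measurable lebesgue"
    by (auto intro: measurable_completion)
  have "(LINT k|lebesgue. fourier_L1 f k * g k) = (LINT k|lebesgue. fourier_L1 f' k * g' k)"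
    unfolding F by (rule integral_cong_AE) (use gg' in auto)
  also have "\<dots> = (LINT k|lborel. fourier_L1 f' k * g' k)"
    by (rule integral_completion) simp
  also have "\<dots> = (LINT x|lborel. f' x * fourier_L1 g' x)"
    by (rule fourier_multiplication_lborel[OF int])
  also have "\<dots> = (LINT x|lebesgue. f' x * fourier_L1 g' x)"
    by (rule integral_completion[symmetric]) simp
  also have "\<dots> = (LINT x|lebesgue. f x * fourier_L1 g x)"
    unfolding F by (rule integral_cong_AE) (use ff' in auto)
  finally show ?thesis .
qed

text \<open>This is the convolution of f with its reflected conjugate, the function whose transform
  is the squared modulus of the transform of f and whose value at 0 is the integral of
  |f|^2.\<close>

definition autocorrelation :: "(real ^ 'n \<Rightarrow> complex) \<Rightarrow> real ^ 'n \<Rightarrow> complex" where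
  "autocorrelation f u = (LINT y|lborel. f (y + u) * cnj (f y))"

lemma
  fixes f :: "real ^ 'n \<Rightarrow> complex"
  assumes f: "integrable lborel f"
  shows integrable_autocorrelation: "integrable lborel (autocorrelation f)"
    and fourier_autocorrelation:
      "fourier_L1 (autocorrelation f) k = complex_of_real ((cmod (fourier_L1 f k))\<^sup>2)"
proof -
  have f_meas [measurable]: "f \<in> borel_measurable borel" using f by auto
  have shift: "(\<lambda>u. h (y + u)) = (\<lambda>u. h (u + y))" for h :: "real ^ 'n \<Rightarrow> 'b" and y
    by (simp add: add.commute)
  have [measurable]: "cnj \<in> borel_measurable borel"
    by (rule borel_measurable_continuous_onI) (intro continuous_intros)
  have f_shift: "integrable lborel (\<lambda>u. f (y + u))" for y
    unfolding shift[of f] using f lborel_integrable_shift[OF f_meas] by blast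
  \<comment> \<open>The unimodular factor c is left open so that one argument covers two uses: c = 1
    for the integrability of the autocorrelation and c an exponential for the exchange of integrals
    in its transform.\<close>
  have int: "integrable (lborel \<Otimes>\<^sub>M lborel) (\<lambda>(y, u). f (y + u) * cnj (f y) * c u)"
    if [measurable]: "c \<in> borel_measurable borel" and c: "\<And>u. cmod (c u) = 1" for c
  proof (rule lborel_pair.Fubini_integrable)
    show "(\<lambda>(y, u). f (y + u) * cnj (f y) * c u) \<in> borel_measurable (lborel \<Otimes>\<^sub>M lborel)"
      by measurable
    have "(LINT u|lborel. cmod (f (y + u))) = (LINT u|lborel. cmod (f u))" for y
      unfolding shift[of "\<lambda>x. cmod (f x)"] by (rule lborel_integral_shift) auto
    then show "integrable lborel (\<lambda>y. LINT u|lborel. norm (case (y, u) of (y, u) \<Rightarrow> f (y + u) * cnj (f y) * c u))"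
      using f by (simp add: norm_mult c)
    have "integrable lborel (\<lambda>u. cnj (f y) * (f (y + u) * c u))" for y
      by (intro integrable_mult_right integrable_mult_unimodular f_shift c) measurable
    then show "AE y in lborel. integrable lborel (\<lambda>u. case (y, u) of (y, u) \<Rightarrow> f (y + u) * cnj (f y) * c u)"
      by (simp add: mult_ac)
  qed
  show A: "integrable lborel (autocorrelation f)"
    unfolding autocorrelation_def[abs_def]
    using lborel_pair.integrable_snd[OF int[of "\<lambda>_. 1"]] by simp
  have A_meas: "autocorrelation f \<in> borel_measurable borel" using A by auto
  have "fourier_L1 (autocorrelation f) k =
      (LINT u|lborel. (LINT y|lborel. f (y + u) * cnj (f y) * character (- (k \<bullet> u))))"
    by (simp add: fourier_L1_lborel[OF A_meas] autocorrelation_def)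
  also have "\<dots> = (LINT y|lborel. (LINT u|lborel. f (y + u) * cnj (f y) * character (- (k \<bullet> u))))"
    by (rule lborel_pair.Fubini_integral[OF int]) auto
  also have "\<dots> = (LINT y|lborel. cnj (f y * character (- (k \<bullet> y))) * fourier_L1 f k)"
  proof (rule Bochner_Integration.integral_cong[OF refl])
    fix y
    \<comment> \<open>Splitting the exponential at y + u separates the variables up to a
      translation, under which the inner integral is invariant.\<close>
    have "f (y + u) * cnj (f y) * character (- (k \<bullet> u)) =
        cnj (f y * character (- (k \<bullet> y))) * (f (y + u) * character (- (k \<bullet> (y + u))))" for u
    proof -
      have "character (- (k \<bullet> u)) = character (k \<bullet> y) * character (- (k \<bullet> (y + u)))"
        by (simp add: character_add[symmetric] inner_add_right)
      then show ?thesis by (simp add: cnj_character)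
    qed
    then have "(LINT u|lborel. f (y + u) * cnj (f y) * character (- (k \<bullet> u))) =
        cnj (f y * character (- (k \<bullet> y))) * (LINT u|lborel. f (y + u) * character (- (k \<bullet> (y + u))))"
      by (simp only: Bochner_Integration.integral_mult_right_zero)
    also have "(LINT u|lborel. f (y + u) * character (- (k \<bullet> (y + u)))) = fourier_L1 f k"
      unfolding shift[of "\<lambda>v. f v * character (- (k \<bullet> v))"] fourier_L1_lborel[OF f_meas]
      by (rule lborel_integral_shift) auto
    finally show "(LINT u|lborel. f (y + u) * cnj (f y) * character (- (k \<bullet> u))) =
        cnj (f y * character (- (k \<bullet> y))) * fourier_L1 f k" .
  qed
  also have "\<dots> = cnj (fourier_L1 f k) * fourier_L1 f k"
    unfolding fourier_L1_lborel[OF f_meas]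
    by (simp only: Bochner_Integration.integral_mult_left_zero Bochner_Integration.integral_cnj)
  also have "\<dots> = complex_of_real ((cmod (fourier_L1 f k))\<^sup>2)"
    by (simp add: complex_norm_square[symmetric] mult.commute)
  finally show "fourier_L1 (autocorrelation f) k = complex_of_real ((cmod (fourier_L1 f k))\<^sup>2)" .
qed

text \<open>The argument \<open>s *\<^sub>R w\<close> and the Jacobian \<open>s ^ CARD('n)\<close>
  appear in exactly this combination after a dilation by s of the integral of the autocorrelation
  against the transform of the scaled Gaussian.\<close>

lemma fourier_gauss_scaled:
  fixes w :: "real ^ 'n"
  assumes "s > 0"
  shows "s ^ CARD('n) *\<^sub>R fourier_L1 (\<lambda>k. complex_of_real (gauss (s *\<^sub>R k))) (s *\<^sub>R w) = gauss w"
proof -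
  have "complex_of_real (gauss w) = (LINT x|lborel. complex_of_real (gauss x) * character (- (w \<bullet> x)))"
    by (rule fourier_gauss[symmetric])
  also have "\<dots> = \<bar>s\<bar> ^ DIM(real ^ 'n) *\<^sub>R
      (LINT x|lborel. complex_of_real (gauss (s *\<^sub>R x)) * character (- (w \<bullet> (s *\<^sub>R x))))"
    by (rule lborel_integral_scaleR) (use assms in auto)
  also have "\<dots> = s ^ CARD('n) *\<^sub>R fourier_L1 (\<lambda>k. complex_of_real (gauss (s *\<^sub>R k))) (s *\<^sub>R w)"
    using assms by (subst fourier_L1_lborel) auto
  finally show ?thesis by simp
qed

text \<open>The multiplication formula is applied to the autocorrelation and a scaled Gaussian, and
  the result is rescaled so that s moves from the Gaussian into the argument of the autocorrelation.
  The left integral converges because the transform is bounded by the L1 norm.\<close>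

lemma gaussian_Plancherel:
  fixes f :: "real ^ 'n \<Rightarrow> complex"
  assumes f: "integrable lborel f" and "s > 0"
  shows "integrable lborel (\<lambda>k. (cmod (fourier_L1 f k))\<^sup>2 * gauss (s *\<^sub>R k))"
    and "complex_of_real (LINT k|lborel. (cmod (fourier_L1 f k))\<^sup>2 * gauss (s *\<^sub>R k)) =
      (LINT w|lborel. autocorrelation f (s *\<^sub>R w) * gauss w)"
proof -
  define A where "A = autocorrelation f"
  define E where "E k = complex_of_real (gauss (s *\<^sub>R k))" for k :: "real ^ 'n"
  have A: "integrable lborel A" unfolding A_def by (rule integrable_autocorrelation[OF f])
  have gauss_int: "integrable lborel (\<lambda>k::real^'n. gauss (s *\<^sub>R k))"
    by (rule lborel_integrable_scaleR[OF integrable_gauss]) (use \<open>s > 0\<close> in simp)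
  then have E: "integrable lborel E" by (simp add: E_def[abs_def])
  have "integrable lebesgue f" "integrable lebesgue E"
    using f E integrable_completion[of f lborel] integrable_completion[of E lborel] by auto
  then have [measurable]: "fourier_L1 f \<in> borel_measurable borel" "fourier_L1 E \<in> borel_measurable borel"
    by (auto intro: borel_measurable_fourier_L1)
  have [measurable]: "A \<in> borel_measurable borel" using A by auto
  let ?C = "(LINT x|lebesgue. cmod (f x))\<^sup>2"
  show "integrable lborel (\<lambda>k. (cmod (fourier_L1 f k))\<^sup>2 * gauss (s *\<^sub>R k))"
  proof (rule Bochner_Integration.integrable_bound[OF integrable_mult_right[OF gauss_int, of ?C]])
    show "AE k in lborel. norm ((cmod (fourier_L1 f k))\<^sup>2 * gauss (s *\<^sub>R k)) \<le> norm (?C * gauss (s *\<^sub>R k))"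
      by (auto simp: abs_mult intro!: mult_right_mono power_mono cmod_fourier_L1_le)
  qed auto
  have "complex_of_real (LINT k|lborel. (cmod (fourier_L1 f k))\<^sup>2 * gauss (s *\<^sub>R k)) =
      (LINT k|lborel. fourier_L1 A k * E k)"
    by (simp add: A_def E_def fourier_autocorrelation[OF f] flip: integral_complex_of_real)
  also have "\<dots> = (LINT u|lborel. A u * fourier_L1 E u)"
    by (rule fourier_multiplication_lborel[OF A E])
  also have "\<dots> = \<bar>s\<bar> ^ DIM(real ^ 'n) *\<^sub>R (LINT w|lborel. A (s *\<^sub>R w) * fourier_L1 E (s *\<^sub>R w))"
    by (rule lborel_integral_scaleR) (use \<open>s > 0\<close> in auto)
  also have "\<dots> = (LINT w|lborel. A (s *\<^sub>R w) * (s ^ CARD('n) *\<^sub>R fourier_L1 E (s *\<^sub>R w)))"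
    using \<open>s > 0\<close> by (simp flip: integral_scaleR_right)
  also have "\<dots> = (LINT w|lborel. A (s *\<^sub>R w) * gauss w)"
    unfolding E_def[abs_def] fourier_gauss_scaled[OF \<open>s > 0\<close>] ..
  finally show "complex_of_real (LINT k|lborel. (cmod (fourier_L1 f k))\<^sup>2 * gauss (s *\<^sub>R k)) =
      (LINT w|lborel. autocorrelation f (s *\<^sub>R w) * gauss w)"
    by (simp only: A_def)
qed

section \<open>Plancherel's theorem\<close>

lemma autocorrelation_0:
  assumes "f \<in> compact_support_cont"
  shows "autocorrelation f 0 = complex_of_real ((L2_norm f)\<^sup>2)"
proof -
  have [measurable]: "f \<in> borel_measurable borel" by (rule compact_support_cont_measurable[OF assms])
  have "(\<lambda>x. f x * cnj (f x)) \<in> borel_measurable lborel"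
    by (simp flip: complex_norm_square)
  then have "autocorrelation f 0 = L2_inner f f"
    unfolding autocorrelation_def L2_inner_def by (simp add: integral_completion)
  then show ?thesis by (simp only: L2_inner_self)
qed

text \<open>Continuity and boundedness of f make the right side of the damped identity converge to
  the autocorrelation at 0, by dominated convergence. On the left no integrable majorant is known
  yet, but the integrands increase as the damping is removed, so monotone convergence gives both
  membership in L2 and the norm.\<close>

lemma Plancherel_compact_support:
  fixes f :: "real ^ 'n \<Rightarrow> complex"
  assumes f: "f \<in> compact_support_cont"
  shows "fourier_L1 f \<in> L2_fun" and "L2_norm (fourier_L1 f) = L2_norm f"
proof -
  have int: "integrable lborel f" by (rule compact_support_cont_integrable_lborel[OF f])
  have f_meas [measurable]: "f \<in> borel_measurable borel" by (rule compact_support_cont_measurable[OF f])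
  have [measurable]: "fourier_L1 f \<in> borel_measurable borel"
    by (rule borel_measurable_fourier_L1[OF compact_support_cont_integrable[OF f]])
  have [measurable]: "cnj \<in> borel_measurable borel"
    by (rule borel_measurable_continuous_onI) (intro continuous_intros)
  obtain B where B: "\<And>x. cmod (f x) \<le> B" using compact_support_cont_bounded[OF f] by blast
  define A where "A = autocorrelation f"
  have [measurable]: "A \<in> borel_measurable borel"
    using integrable_autocorrelation[OF int] unfolding A_def by auto
  define s where "s m = 1 / real (Suc m)" for m
  have s_lim: "s \<longlonglongrightarrow> 0" unfolding s_def by (rule LIMSEQ_Suc[OF lim_1_over_n])
  have s_pos: "s m > 0" for m by (simp add: s_def)
  \<comment> \<open>Bounding the shifted factor by B leaves a majorant that does not depend on the
    shift. It serves twice: for the limit of the autocorrelation at 0, and for the uniform bound on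
    it under the Gaussian integral.\<close>
  have w: "integrable lborel (\<lambda>y. B * cmod (f y))" using int by simp
  have A_le: "cmod (A u) \<le> (LINT y|lborel. B * cmod (f y))" for u
  proof -
    have bd: "AE y in lborel. norm (f (y + u) * cnj (f y)) \<le> norm (B * cmod (f y))"
      using B by (auto simp: norm_mult abs_mult intro!: mult_right_mono order_trans[OF B abs_ge_self])
    have "integrable lborel (\<lambda>y. f (y + u) * cnj (f y))"
      by (rule Bochner_Integration.integrable_bound[OF w _ bd]) measurable
    from Bochner_Integration.integral_norm_bound_integral[OF this w]
    have "norm (LINT y|lborel. f (y + u) * cnj (f y)) \<le> (LINT y|lborel. B * cmod (f y))"
      by (simp add: norm_mult mult_right_mono B)
    then show ?thesis by (simp add: A_def autocorrelation_def)
  qed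
  have A_lim: "(\<lambda>m. A (s m *\<^sub>R w)) \<longlonglongrightarrow> A 0" for w
    unfolding A_def autocorrelation_def
  proof (rule integral_dominated_convergence[OF _ _ w])
    show "AE y in lborel. (\<lambda>m. f (y + s m *\<^sub>R w) * cnj (f y)) \<longlonglongrightarrow> f (y + 0) * cnj (f y)"
    proof (rule AE_I2)
      fix y
      have "(\<lambda>m. y + s m *\<^sub>R w) \<longlonglongrightarrow> y + 0 *\<^sub>R w" by (intro tendsto_intros s_lim)
      then have "(\<lambda>m. f (y + s m *\<^sub>R w)) \<longlonglongrightarrow> f (y + 0 *\<^sub>R w)"
        by (intro continuous_on_tendsto_compose[OF compact_support_cont_continuous[OF f]]) auto
      then show "(\<lambda>m. f (y + s m *\<^sub>R w) * cnj (f y)) \<longlonglongrightarrow> f (y + 0) * cnj (f y)"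
        by (intro tendsto_mult tendsto_const) simp
    qed
    show "AE y in lborel. norm (f (y + s m *\<^sub>R w) * cnj (f y)) \<le> B * cmod (f y)" for m
      by (auto simp: norm_mult intro!: mult_right_mono B)
  qed measurable
  define r where "r m = (LINT k|lborel. (cmod (fourier_L1 f k))\<^sup>2 * gauss (s m *\<^sub>R k))" for m
  have "(\<lambda>m. LINT w|lborel. A (s m *\<^sub>R w) * complex_of_real (gauss w)) \<longlonglongrightarrow>
      (LINT w::real^'n|lborel. A 0 * complex_of_real (gauss w))"
  proof (rule integral_dominated_convergence)
    show "integrable lborel (\<lambda>w::real^'n. (LINT y|lborel. B * cmod (f y)) * gauss w)"
      by (rule integrable_mult_right[OF integrable_gauss])
    show "AE w in lborel. (\<lambda>m. A (s m *\<^sub>R w) * complex_of_real (gauss w)) \<longlonglongrightarrow> A 0 * complex_of_real (gauss w)"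
      by (intro AE_I2 tendsto_mult A_lim tendsto_const)
    show "AE w in lborel. norm (A (s m *\<^sub>R w) * complex_of_real (gauss w)) \<le> (LINT y|lborel. B * cmod (f y)) * gauss w" for m
    proof (rule AE_I2)
      fix w :: "real ^ 'n"
      have "norm (complex_of_real (gauss w)) = gauss w" by (simp add: gauss_def)
      moreover have "0 \<le> gauss w" by (simp add: gauss_def)
      ultimately show "norm (A (s m *\<^sub>R w) * complex_of_real (gauss w)) \<le> (LINT y|lborel. B * cmod (f y)) * gauss w"
        using A_le[of "s m *\<^sub>R w"] by (simp only: norm_mult) (rule mult_right_mono)
    qed
  qed measurable
  also have "(LINT w::real^'n|lborel. A 0 * complex_of_real (gauss w)) = complex_of_real ((L2_norm f)\<^sup>2)"
    by (simp add: A_def autocorrelation_0[OF f] integral_gauss)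
  finally have "(\<lambda>m. complex_of_real (r m)) \<longlonglongrightarrow> complex_of_real ((L2_norm f)\<^sup>2)"
    by (simp only: r_def gaussian_Plancherel(2)[OF int s_pos] A_def)
  then have r_lim: "r \<longlonglongrightarrow> (L2_norm f)\<^sup>2" by (simp only: tendsto_of_real_iff)
  have mono: "mono (\<lambda>m. (cmod (fourier_L1 f k))\<^sup>2 * gauss (s m *\<^sub>R k))" for k
  proof (rule monoI, rule mult_left_mono)
    fix m l :: nat assume "m \<le> l"
    then have "s l \<le> s m" by (simp add: s_def frac_le)
    then have "(s l * norm k)\<^sup>2 \<le> (s m * norm k)\<^sup>2"
      using s_pos[of l] by (intro power_mono mult_right_mono) auto
    then show "gauss (s m *\<^sub>R k) \<le> gauss (s l *\<^sub>R k)"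
      using s_pos[of l] s_pos[of m] by (simp add: gauss_def)
  qed simp
  have lim: "(\<lambda>m. (cmod (fourier_L1 f k))\<^sup>2 * gauss (s m *\<^sub>R k)) \<longlonglongrightarrow> (cmod (fourier_L1 f k))\<^sup>2" for k
  proof -
    have "(\<lambda>m. gauss (s m *\<^sub>R k)) \<longlonglongrightarrow> exp (- pi * (norm (0 *\<^sub>R k))\<^sup>2)"
      unfolding gauss_def by (intro tendsto_intros s_lim)
    then have "(\<lambda>m. (cmod (fourier_L1 f k))\<^sup>2 * gauss (s m *\<^sub>R k)) \<longlonglongrightarrow> (cmod (fourier_L1 f k))\<^sup>2 * 1"
      by (intro tendsto_mult tendsto_const) simp
    then show ?thesis by simp
  qed
  have main: "integrable lborel (\<lambda>k. (cmod (fourier_L1 f k))\<^sup>2)"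
    "(LINT k|lborel. (cmod (fourier_L1 f k))\<^sup>2) = (L2_norm f)\<^sup>2"
    using integrable_monotone_convergence[OF gaussian_Plancherel(1)[OF int s_pos] AE_I2[OF mono]
        AE_I2[OF lim] r_lim[unfolded r_def[abs_def]]]
      integral_monotone_convergence[OF gaussian_Plancherel(1)[OF int s_pos] AE_I2[OF mono]
        AE_I2[OF lim] r_lim[unfolded r_def[abs_def]]] by auto
  have "integrable lebesgue (\<lambda>k. (cmod (fourier_L1 f k))\<^sup>2)"
    using main(1) by (subst integrable_completion) auto
  then show "fourier_L1 f \<in> L2_fun"
    by (simp add: L2_fun_def measurable_completion)
  have "(L2_norm (fourier_L1 f))\<^sup>2 = (L2_norm f)\<^sup>2"
    unfolding L2_norm_square[of "fourier_L1 f"] main(2)[symmetric]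
    by (rule integral_completion) measurable
  then show "L2_norm (fourier_L1 f) = L2_norm f"
    by (simp add: L2_norm_nonneg power2_eq_iff_nonneg)
qed

lemma compact_support_cont_diff:
  assumes "f \<in> compact_support_cont" "g \<in> compact_support_cont"
  shows "(\<lambda>x. f x - g x) \<in> compact_support_cont"
proof -
  obtain R S where "\<And>x. norm x > R \<Longrightarrow> f x = 0" "\<And>x. norm x > S \<Longrightarrow> g x = 0"
    using assms by (auto simp: compact_support_cont_def)
  then have "\<forall>x. norm x > max R S \<longrightarrow> f x - g x = 0" by simp
  then show ?thesis
    using assms unfolding compact_support_cont_def by (blast intro: continuous_on_diff)
qed

text \<open>For approximants converging in both norms, the transforms converge pointwise by the L1
  bound, and their mutual L2 distances equal those of the approximants. Fatou, applied in one of the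
  two indices, shows that the pointwise limit is also the L2 limit, so the isometry
  survives.\<close>

theorem Plancherel:
  fixes f :: "real ^ 'n \<Rightarrow> complex"
  assumes f2: "f \<in> L2_fun" and f1: "integrable lebesgue f"
  shows "fourier_L1 f \<in> L2_fun" and "L2_norm (fourier_L1 f) = L2_norm f"
proof -
  obtain G where G: "\<And>j. G j \<in> compact_support_cont" and lim2: "L2_tendsto G f"
    and lim1: "(\<lambda>j. LINT x|lebesgue. cmod (f x - G j x)) \<longlonglongrightarrow> 0"
    using compact_support_cont_dense[OF f2] f1 by metis
  have G_int: "integrable lebesgue (G j)" for j by (rule compact_support_cont_integrable[OF G])
  have FG: "fourier_L1 (G j) \<in> L2_fun" for j by (rule Plancherel_compact_support(1)[OF G])
  have pointwise: "(\<lambda>j. fourier_L1 (G j) k) \<longlonglongrightarrow> fourier_L1 f k" for k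
  proof -
    have "cmod (fourier_L1 f k - fourier_L1 (G j) k) \<le> (LINT x|lebesgue. cmod (f x - G j x))" for j
      using cmod_fourier_L1_le[of "\<lambda>x. f x - G j x" k] by (simp add: fourier_L1_diff[OF f1 G_int])
    from tendsto_0_if_le[OF norm_ge_zero this lim1]
    have "(\<lambda>j. fourier_L1 f k - fourier_L1 (G j) k) \<longlonglongrightarrow> 0"
      by (simp only: tendsto_norm_zero_iff)
    from tendsto_diff[OF tendsto_const[of "fourier_L1 f k"] this] show ?thesis by simp
  qed
  have F_meas: "fourier_L1 f \<in> borel_measurable lebesgue"
    by (rule measurable_completion) (simp add: borel_measurable_fourier_L1[OF f1])
  have close: "(\<lambda>k. fourier_L1 (G j) k - fourier_L1 f k) \<in> L2_fun \<and>
      L2_norm (\<lambda>k. fourier_L1 (G j) k - fourier_L1 f k) \<le> e"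
    if N: "\<And>i. i \<ge> N \<Longrightarrow> L2_norm (\<lambda>x. G j x - G i x) < e" for j N e
  proof -
    have eq: "L2_norm (\<lambda>k. fourier_L1 (G j) k - fourier_L1 (G i) k) = L2_norm (\<lambda>x. G j x - G i x)" for i
      using Plancherel_compact_support(2)[OF compact_support_cont_diff[OF G[of j] G[of i]]]
      by (simp add: fourier_L1_diff[OF G_int G_int, abs_def])
    have "\<forall>\<^sub>F i in sequentially. L2_norm (\<lambda>k. fourier_L1 (G j) k - fourier_L1 (G i) k) \<le> e"
      using eventually_ge_at_top[of N] by eventually_elim (simp add: eq N less_imp_le)
    moreover have "AE k in lebesgue. (\<lambda>i. fourier_L1 (G j) k - fourier_L1 (G i) k)
        \<longlonglongrightarrow> fourier_L1 (G j) k - fourier_L1 f k"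
      by (intro AE_I2 tendsto_diff tendsto_const pointwise)
    moreover have "(\<lambda>k. fourier_L1 (G j) k - fourier_L1 f k) \<in> borel_measurable lebesgue"
      using F_meas L2_fun_measurable[OF FG] by measurable
    ultimately show ?thesis
      using L2_Fatou[of "\<lambda>i k. fourier_L1 (G j) k - fourier_L1 (G i) k"] L2_fun_diff[OF FG FG] by blast
  qed
  have cauchy: "\<exists>N. \<forall>m\<ge>N. \<forall>l\<ge>N. L2_norm (\<lambda>x. G m x - G l x) < e" if "e > 0" for e
    using L2_tendsto_imp_Cauchy[OF lim2] that by (simp add: L2_Cauchy_def)
  obtain N where "\<And>m l. m \<ge> N \<Longrightarrow> l \<ge> N \<Longrightarrow> L2_norm (\<lambda>x. G m x - G l x) < 1"
    using cauchy[of 1] by auto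
  then have "(\<lambda>k. fourier_L1 (G N) k - fourier_L1 f k) \<in> L2_fun"
    using close[of N N 1] by auto
  from L2_fun_diff[OF FG[of N] this] show F: "fourier_L1 f \<in> L2_fun" by simp
  have "(\<lambda>j. L2_norm (\<lambda>k. fourier_L1 (G j) k - fourier_L1 f k)) \<longlonglongrightarrow> 0"
  proof (rule LIMSEQ_I)
    fix e :: real assume "e > 0"
    then obtain N where "\<And>m l. m \<ge> N \<Longrightarrow> l \<ge> N \<Longrightarrow> L2_norm (\<lambda>x. G m x - G l x) < e / 2"
      using cauchy[of "e / 2"] by auto
    then have le: "L2_norm (\<lambda>k. fourier_L1 (G j) k - fourier_L1 f k) \<le> e / 2" if "j \<ge> N" for j
      using close[of N j "e / 2"] that by auto
    have "norm (L2_norm (\<lambda>k. fourier_L1 (G j) k - fourier_L1 f k) - 0) < e" if "j \<ge> N" for j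
      using le[OF that] \<open>e > 0\<close> by (simp add: L2_norm_nonneg)
    then show "\<exists>N. \<forall>j\<ge>N. norm (L2_norm (\<lambda>k. fourier_L1 (G j) k - fourier_L1 f k) - 0) < e" by blast
  qed
  then have "L2_tendsto (\<lambda>j. fourier_L1 (G j)) (fourier_L1 f)"
    by (simp add: L2_tendsto_def FG F)
  then have "(\<lambda>j. L2_norm (G j)) \<longlonglongrightarrow> L2_norm (fourier_L1 f)"
    using L2_tendsto_norm by (simp only: Plancherel_compact_support(2)[OF G, symmetric])
  then show "L2_norm (fourier_L1 f) = L2_norm f"
    using L2_tendsto_norm[OF lim2] LIMSEQ_unique by blast
qed

section \<open>The Fourier transform on $L^2$\<close>

text \<open>This is the graph of the L2 transform, the very condition inside the choice that defines
  \<open>fourier_L2\<close>. As a relation it is stable under linear combinations and changes on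
  null sets, neither of which a chosen representative respects on the nose.\<close>

definition fourier_rel :: "(real ^ 'n \<Rightarrow> complex) \<Rightarrow> (real ^ 'n \<Rightarrow> complex) \<Rightarrow> bool" where
  "fourier_rel f h \<longleftrightarrow> (\<exists>F. (\<forall>m. integrable lebesgue (F m)) \<and> L2_tendsto F f \<and>
      L2_tendsto (\<lambda>m. fourier_L1 (F m)) h)"

lemma fourier_relI:
  "(\<And>m. integrable lebesgue (F m)) \<Longrightarrow> L2_tendsto F f \<Longrightarrow> L2_tendsto (\<lambda>m. fourier_L1 (F m)) h
    \<Longrightarrow> fourier_rel f h"
  unfolding fourier_rel_def by blast

lemma fourier_relE:
  assumes "fourier_rel f h"
  obtains F where "\<forall>m. integrable lebesgue (F m)" "\<forall>m. F m \<in> L2_fun" "L2_tendsto F f"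
    "L2_tendsto (\<lambda>m. fourier_L1 (F m)) h"
  using assms unfolding fourier_rel_def L2_tendsto_def by blast

lemma
  assumes "fourier_rel f h"
  shows fourier_rel_L2_left: "f \<in> L2_fun" and fourier_rel_L2_right: "h \<in> L2_fun"
  using assms unfolding fourier_rel_def L2_tendsto_def by blast+

lemma fourier_rel_add:
  assumes "fourier_rel f h" "fourier_rel g k"
  shows "fourier_rel (\<lambda>x. f x + g x) (\<lambda>x. h x + k x)"
proof -
  obtain F where F: "\<And>m. integrable lebesgue (F m)" "L2_tendsto F f"
      "L2_tendsto (\<lambda>m. fourier_L1 (F m)) h"
    using assms(1) by (rule fourier_relE) blast
  obtain G where G: "\<And>m. integrable lebesgue (G m)" "L2_tendsto G g"
      "L2_tendsto (\<lambda>m. fourier_L1 (G m)) k"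
    using assms(2) by (rule fourier_relE) blast
  show ?thesis
  proof (rule fourier_relI)
    show "integrable lebesgue (\<lambda>x. F m x + G m x)" for m
      using F(1) G(1) by simp
    show "L2_tendsto (\<lambda>m x. F m x + G m x) (\<lambda>x. f x + g x)"
      by (rule L2_tendsto_add[OF F(2) G(2)])
    show "L2_tendsto (\<lambda>m. fourier_L1 (\<lambda>x. F m x + G m x)) (\<lambda>x. h x + k x)"
      using L2_tendsto_add[OF F(3) G(3)] by (simp add: fourier_L1_add[OF F(1) G(1), abs_def])
  qed
qed

lemma fourier_rel_scale:
  assumes "fourier_rel f h"
  shows "fourier_rel (\<lambda>x. c * f x) (\<lambda>x. c * h x)"
proof -
  obtain F where F: "\<And>m. integrable lebesgue (F m)" "L2_tendsto F f"
      "L2_tendsto (\<lambda>m. fourier_L1 (F m)) h"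
    using assms by (rule fourier_relE) blast
  show ?thesis
  proof (rule fourier_relI)
    show "integrable lebesgue (\<lambda>x. c * F m x)" for m using F(1) by simp
    show "L2_tendsto (\<lambda>m x. c * F m x) (\<lambda>x. c * f x)" by (rule L2_tendsto_scale[OF F(2)])
    show "L2_tendsto (\<lambda>m. fourier_L1 (\<lambda>x. c * F m x)) (\<lambda>x. c * h x)"
      using L2_tendsto_scale[OF F(3)] by (simp add: fourier_L1_scale[abs_def])
  qed
qed

lemma fourier_rel_diff:
  assumes "fourier_rel f h" "fourier_rel g k"
  shows "fourier_rel (\<lambda>x. f x - g x) (\<lambda>x. h x - k x)"
  using fourier_rel_add[OF assms(1) fourier_rel_scale[OF assms(2), of "-1"]] by simp

lemma fourier_rel_cong_AE:
  assumes "fourier_rel f h" "AE x in lebesgue. f x = g x" "AE x in lebesgue. h x = k x"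
  shows "fourier_rel g k"
  using assms unfolding fourier_rel_def by (blast intro: L2_tendsto_cong_AE)

lemma fourier_rel_L1:
  assumes "f \<in> L2_fun" "integrable lebesgue f" shows "fourier_rel f (fourier_L1 f)"
  by (rule fourier_relI[of "\<lambda>_. f"]) (use assms Plancherel in \<open>auto intro: L2_tendsto_const\<close>)

lemma fourier_rel_norm:
  assumes "fourier_rel f h" shows "L2_norm h = L2_norm f"
proof -
  obtain F where F: "\<And>m. integrable lebesgue (F m)" "\<And>m. F m \<in> L2_fun" "L2_tendsto F f"
    "L2_tendsto (\<lambda>m. fourier_L1 (F m)) h"
    using assms by (rule fourier_relE) blast
  have "(\<lambda>m. L2_norm (F m)) \<longlonglongrightarrow> L2_norm h"
    using L2_tendsto_norm[OF F(4)] by (simp only: Plancherel(2)[OF F(2,1)])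
  then show ?thesis using L2_tendsto_norm[OF F(3)] LIMSEQ_unique by blast
qed

text \<open>Polarisation: linearity and norm preservation for f + c g give equality of the real
  parts of the inner products at c = 1 and of the imaginary parts at c = \<i>.\<close>

lemma fourier_rel_inner:
  assumes "fourier_rel f h" "fourier_rel g k"
  shows "L2_inner h k = L2_inner f g"
proof -
  have eq: "Re (cnj c * L2_inner h k) = Re (cnj c * L2_inner f g)" for c
    using fourier_rel_norm[OF fourier_rel_add[OF assms(1) fourier_rel_scale[OF assms(2), of c]]]
      L2_norm_add_square[OF assms[THEN fourier_rel_L2_right], of c]
      L2_norm_add_square[OF assms[THEN fourier_rel_L2_left], of c]
      assms[THEN fourier_rel_norm] by simp
  show ?thesis using eq[of 1] eq[of \<i>] by (simp add: complex_eq_iff)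
qed

text \<open>The difference is again a related pair, so norm preservation makes the norm of h - k
  equal to that of f - g, which is 0.\<close>

lemma fourier_rel_unique:
  assumes "fourier_rel f h" "fourier_rel g k" "AE x in lebesgue. f x = g x"
  shows "AE x in lebesgue. h x = k x"
proof -
  have L2: "(\<lambda>x. h x - k x) \<in> L2_fun" "(\<lambda>x. f x - g x) \<in> L2_fun"
    using fourier_rel_diff[OF assms(1,2)] by (auto dest: fourier_rel_L2_left fourier_rel_L2_right)
  have "L2_norm (\<lambda>x. f x - g x) = 0"
    unfolding L2_norm_eq_0_iff[OF L2(2)] using assms(3) by simp
  then have "L2_norm (\<lambda>x. h x - k x) = 0"
    using fourier_rel_norm[OF fourier_rel_diff[OF assms(1,2)]] by simp
  then show ?thesis unfolding L2_norm_eq_0_iff[OF L2(1)] by simp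
qed

text \<open>The choice is meaningful only if some transform exists. Transforms of compactly
  supported approximants form a Cauchy sequence by the isometry, and completeness supplies the
  limit.\<close>

lemma fourier_rel_fourier_L2:
  fixes f :: "real ^ 'n \<Rightarrow> complex"
  assumes f: "f \<in> L2_fun" shows "fourier_rel f (fourier_L2 f)"
proof -
  obtain G where G: "\<And>j. G j \<in> compact_support_cont" and lim: "L2_tendsto G f"
    using compact_support_cont_dense[OF f] by metis
  have int: "integrable lebesgue (G j)" for j by (rule compact_support_cont_integrable[OF G])
  have L2: "G j \<in> L2_fun" for j by (rule compact_support_cont_L2[OF G])
  have "L2_norm (\<lambda>x. fourier_L1 (G m) x - fourier_L1 (G l) x) = L2_norm (\<lambda>x. G m x - G l x)" for m l
    by (rule fourier_rel_norm[OF fourier_rel_diff]) (rule fourier_rel_L1[OF L2 int])+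
  then have "L2_Cauchy (\<lambda>j. fourier_L1 (G j))"
    using L2_tendsto_imp_Cauchy[OF lim] Plancherel(1)[OF L2 int] by (simp add: L2_Cauchy_def)
  then obtain h where "L2_tendsto (\<lambda>j. fourier_L1 (G j)) h" by (rule Riesz_Fischer)
  then have "fourier_rel f h" by (rule fourier_relI[OF int lim])
  then have "fourier_rel f (SOME h. fourier_rel f h)" by (rule someI[of "fourier_rel f"])
  then show ?thesis by (simp only: fourier_L2_def fourier_rel_def)
qed

section \<open>The inverse transform and inversion\<close>

definition fourier_inv :: "(real ^ 'n \<Rightarrow> complex) \<Rightarrow> real ^ 'n \<Rightarrow> complex" where
  "fourier_inv h x = (LINT k|lebesgue. h k * character (x \<bullet> k))"

text \<open>Conjugation reduces the inverse transform to the forward one, so that continuity, the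
  sup bound and Plancherel carry over.\<close>

lemma fourier_inv_cnj: "fourier_inv h x = cnj (fourier_L1 (\<lambda>k. cnj (h k)) x)"
  unfolding fourier_inv_def fourier_L1_character
  by (simp add: cnj_character flip: Bochner_Integration.integral_cnj)

lemma integrable_cnj_iff: "integrable M (\<lambda>x. cnj (f x)) \<longleftrightarrow> integrable M f"
proof
  assume "integrable M (\<lambda>x. cnj (f x))"
  then have "integrable M (\<lambda>x. cnj (cnj (f x)))" by (rule Bochner_Integration.integrable_cnj)
  then show "integrable M f" by simp
qed (rule Bochner_Integration.integrable_cnj)

lemma continuous_fourier_inv:
  "integrable lebesgue h \<Longrightarrow> continuous_on UNIV (fourier_inv h)"
  unfolding fourier_inv_cnj[abs_def]
  by (intro continuous_on_cnj continuous_fourier_L1) (simp add: integrable_cnj_iff)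

lemma cmod_fourier_inv_le: "cmod (fourier_inv h x) \<le> (LINT k|lebesgue. cmod (h k))"
  using cmod_fourier_L1_le[of "\<lambda>k. cnj (h k)" x] by (simp add: fourier_inv_cnj)

text \<open>This is the multiplication formula for the conjugate of h and for g, conjugated. It lets
  the inverse transform be tested against integrable functions.\<close>

lemma fourier_inv_adjoint:
  fixes h g :: "real ^ 'n \<Rightarrow> complex"
  assumes h: "integrable lebesgue h" and g: "integrable lebesgue g"
  shows "L2_inner (fourier_inv h) g = L2_inner h (fourier_L1 g)"
proof -
  have "L2_inner (fourier_inv h) g = (LINT x|lebesgue. cnj (fourier_L1 (\<lambda>k. cnj (h k)) x * g x))"
    by (simp add: L2_inner_def fourier_inv_cnj)
  also have "\<dots> = cnj (LINT x|lebesgue. fourier_L1 (\<lambda>k. cnj (h k)) x * g x)"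
    by (rule Bochner_Integration.integral_cnj)
  also have "(LINT x|lebesgue. fourier_L1 (\<lambda>k. cnj (h k)) x * g x) =
      (LINT x|lebesgue. cnj (h x) * fourier_L1 g x)"
    by (rule fourier_multiplication[OF _ g]) (simp add: integrable_cnj_iff h)
  also have "cnj \<dots> = (LINT x|lebesgue. cnj (cnj (h x) * fourier_L1 g x))"
    by (rule Bochner_Integration.integral_cnj[symmetric])
  also have "\<dots> = L2_inner h (fourier_L1 g)" by (simp add: L2_inner_def)
  finally show ?thesis .
qed

lemma L2_fun_indicator:
  assumes "S \<in> sets lebesgue" "emeasure lebesgue S < \<infinity>"
  shows "(\<lambda>x. indicator S x) \<in> L2_fun"
proof -
  have "(\<lambda>x. (cmod (indicator S x))\<^sup>2) = indicat_real S"
    by (auto simp: fun_eq_iff indicator_def)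
  then show ?thesis using assms by (simp add: L2_fun_def)
qed

lemma L2_fun_mult_indicator:
  assumes "f \<in> L2_fun" "S \<in> sets lebesgue"
  shows "(\<lambda>x. f x * indicator S x) \<in> L2_fun"
proof (rule L2_fun_dominated[OF _ L2_fun_integrable[OF assms(1)]])
  show "(\<lambda>x. f x * indicator S x) \<in> borel_measurable lebesgue"
    using L2_fun_measurable[OF assms(1)] assms(2) by measurable
qed (auto simp: indicator_def)

lemma integrable_L2_mult_indicator:
  assumes "f \<in> L2_fun" "S \<in> sets lebesgue" "emeasure lebesgue S < \<infinity>"
  shows "integrable lebesgue (\<lambda>x. f x * indicator S x)"
  by (rule integrable_L2_mult[OF assms(1) L2_fun_indicator[OF assms(2,3)]])

text \<open>Both functions have the same inner product with their difference restricted to any ball.\<close>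

theorem fourier_inversion:
  fixes f h :: "real ^ 'n \<Rightarrow> complex"
  assumes rel: "fourier_rel f h" and h: "integrable lebesgue h"
  shows "AE x in lebesgue. fourier_inv h x = f x"
proof -
  have f_L2: "f \<in> L2_fun" by (rule fourier_rel_L2_left[OF rel])
  have inv_meas: "fourier_inv h \<in> borel_measurable lebesgue"
    by (rule measurable_completion) (simp add: borel_measurable_continuous_onI[OF continuous_fourier_inv[OF h]])
  have "AE x in lebesgue. norm x \<le> real j \<longrightarrow> fourier_inv h x = f x" for j :: nat
  proof -
    let ?I = "\<lambda>x. indicator (cball 0 (real j)) x :: complex"
    have ball: "cball (0 :: real ^ 'n) (real j) \<in> sets lebesgue"
      "emeasure lebesgue (cball (0 :: real ^ 'n) (real j)) < \<infinity>"
      using emeasure_bounded_finite[OF bounded_cball] by auto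
    define p where "p x = fourier_inv h x * ?I x" for x
    define q where "q x = f x * ?I x" for x
    define g where "g x = p x - q x" for x
    let ?C = "LINT k|lebesgue. cmod (h k)"
    have p_meas [measurable]: "p \<in> borel_measurable lebesgue"
      unfolding p_def using inv_meas ball(1) by measurable
    have C: "?C \<ge> 0" by simp
    have p_L2: "p \<in> L2_fun"
    proof (rule L2_fun_dominated[OF p_meas])
      show "integrable lebesgue (\<lambda>x::real^'n. ?C\<^sup>2 * indicat_real (cball 0 (real j)) x)"
        using ball by (intro integrable_mult_right integrable_real_indicator) auto
      show "AE x in lebesgue. (cmod (p x))\<^sup>2 \<le> ?C\<^sup>2 * indicat_real (cball 0 (real j)) x"
        using cmod_fourier_inv_le[of h] by (auto simp: p_def indicator_def intro!: power_mono)
    qed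
    have q_L2: "q \<in> L2_fun" unfolding q_def by (rule L2_fun_mult_indicator[OF f_L2 ball(1)])
    have g_L2: "g \<in> L2_fun" unfolding g_def by (rule L2_fun_diff[OF p_L2 q_L2])
    have g_I: "g x * ?I x = g x" "cnj (g x) = ?I x * cnj (g x)" for x
      by (auto simp: g_def p_def q_def indicator_def)
    \<comment> \<open>A square-integrable function supported in a ball is integrable. So g meets the
      demands of both facts used below: the adjoint formula, which asks for integrability, and the
      preservation of inner products.\<close>
    have g_int: "integrable lebesgue g"
      using integrable_L2_mult_indicator[OF g_L2 ball] by (simp only: g_I)
    have "L2_inner p g = L2_inner (fourier_inv h) g"
      unfolding L2_inner_def p_def by (rule Bochner_Integration.integral_cong[OF refl])
        (metis g_I(2) mult.assoc)
    also have "\<dots> = L2_inner h (fourier_L1 g)" by (rule fourier_inv_adjoint[OF h g_int])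
    also have "\<dots> = L2_inner f g" by (rule fourier_rel_inner[OF rel fourier_rel_L1[OF g_L2 g_int]])
    also have "\<dots> = L2_inner q g"
      unfolding L2_inner_def q_def by (rule Bochner_Integration.integral_cong[OF refl])
        (metis g_I(2) mult.assoc)
    finally have "L2_inner g g = 0"
      using L2_inner_diff_left[OF p_L2 q_L2 g_L2] by (simp add: g_def[abs_def])
    then have "L2_norm g = 0" by (simp add: L2_inner_self)
    then have "AE x in lebesgue. g x = 0" by (simp only: L2_norm_eq_0_iff[OF g_L2])
    then show ?thesis
      by eventually_elim (simp add: g_def p_def q_def indicator_def split: if_splits)
  qed
  \<comment> \<open>Balls with integer radii exhaust the space, and the countably many exceptional
    null sets combine into one.\<close>
  then have "AE x in lebesgue. \<forall>j::nat. norm x \<le> real j \<longrightarrow> fourier_inv h x = f x"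
    unfolding AE_all_countable by blast
  then show ?thesis
  proof eventually_elim
    fix x assume "\<forall>j::nat. norm x \<le> real j \<longrightarrow> fourier_inv h x = f x"
    then show "fourier_inv h x = f x" using real_arch_simple[of "norm x"] by blast
  qed
qed

text \<open>The transform \<open>h\<close> of the inverse transform of \<open>u\<close> satisfies \<open>h - u \<bottom> h\<close>, since \<open>h\<close> is a limit
  of transforms of integrable functions; as \<open>h\<close> and \<open>u\<close> have the same norm, they coincide.\<close>

theorem fourier_rel_fourier_inv:
  fixes u :: "real ^ 'n \<Rightarrow> complex"
  assumes u2: "u \<in> L2_fun" and u1: "integrable lebesgue u"
  shows "fourier_rel (fourier_inv u) u"
proof -
  define p where "p = fourier_inv u"
  have cnj_u: "(\<lambda>k. cnj (u k)) \<in> L2_fun" "integrable lebesgue (\<lambda>k. cnj (u k))"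
    using L2_fun_cnj[OF u2] u1 by (auto simp: integrable_cnj_iff)
  have p_eq: "p = (\<lambda>x. cnj (fourier_L1 (\<lambda>k. cnj (u k)) x))"
    by (simp add: p_def fourier_inv_cnj fun_eq_iff)
  have p_L2: "p \<in> L2_fun" unfolding p_eq by (rule L2_fun_cnj[OF Plancherel(1)[OF cnj_u]])
  have p_norm: "L2_norm p = L2_norm u"
    using Plancherel(2)[OF cnj_u] by (simp add: p_eq L2_norm_def)
  define h where "h = fourier_L2 p"
  have rel: "fourier_rel p h" unfolding h_def by (rule fourier_rel_fourier_L2[OF p_L2])
  have h_L2: "h \<in> L2_fun" by (rule fourier_rel_L2_right[OF rel])
  obtain F where F: "\<And>m. integrable lebesgue (F m)" "\<And>m. F m \<in> L2_fun"
    "L2_tendsto (\<lambda>m. fourier_L1 (F m)) h"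
    using rel by (rule fourier_relE) blast
  \<comment> \<open>Both sides equal the inner product of p with \<open>F m\<close>: for u by the
    adjoint formula, for h by preservation of inner products.\<close>
  have "L2_inner u (fourier_L1 (F m)) = L2_inner h (fourier_L1 (F m))" for m
    using fourier_inv_adjoint[OF u1 F(1)[of m]]
      fourier_rel_inner[OF rel fourier_rel_L1[OF F(2) F(1), of m]] by (simp add: p_def)
  then have "(\<lambda>m. L2_inner u (fourier_L1 (F m))) \<longlonglongrightarrow> L2_inner h h"
    using L2_tendsto_inner[OF L2_tendsto_const[OF h_L2] F(3)] by simp
  then have "L2_inner u h = L2_inner h h"
    using L2_tendsto_inner[OF L2_tendsto_const[OF u2] F(3)] LIMSEQ_unique by blast
  \<comment> \<open>Expanding gives ||h||^2 - 2 Re <h,u> + ||u||^2. The middle inner product equals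
    ||h||^2, and ||u|| = ||p|| = ||h||, so everything cancels.\<close>
  then have "(L2_norm (\<lambda>k. h k - u k))\<^sup>2 = 0"
    using L2_norm_add_square[OF h_L2 u2, of "-1"] fourier_rel_norm[OF rel] p_norm
      L2_inner_commute[of h u] by (simp add: L2_inner_self)
  then have "L2_norm (\<lambda>k. h k - u k) = 0" by simp
  then have "AE k in lebesgue. h k = u k"
    by (simp only: L2_norm_eq_0_iff[OF L2_fun_diff[OF h_L2 u2]]) simp
  then show ?thesis
    using fourier_rel_cong_AE[OF rel] by (simp add: p_def)
qed

section \<open>Functions with spectrum of finite measure\<close>

text \<open>Transforms agree almost everywhere, so the vanishing condition may be checked on any of
  them in place of the chosen one.\<close>

lemma spectral_spaceI:
  assumes "fourier_rel f h" "AE k in lebesgue. k \<notin> D \<longrightarrow> h k = 0"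
  shows "f \<in> spectral_space D"
proof -
  have f: "f \<in> L2_fun" by (rule fourier_rel_L2_left[OF assms(1)])
  have "AE k in lebesgue. fourier_L2 f k = h k"
    by (rule fourier_rel_unique[OF fourier_rel_fourier_L2[OF f] assms(1)]) simp
  with assms(2) have "AE k in lebesgue. k \<notin> D \<longrightarrow> fourier_L2 f k = 0"
    by eventually_elim simp
  with f show ?thesis by (simp add: spectral_space_def)
qed

lemma
  assumes "f \<in> spectral_space D"
  shows spectral_space_L2: "f \<in> L2_fun"
    and spectral_space_rel: "fourier_rel f (fourier_L2 f)"
    and spectral_space_AE: "AE k in lebesgue. k \<notin> D \<longrightarrow> fourier_L2 f k = 0"
  using assms by (auto simp: spectral_space_def intro: fourier_rel_fourier_L2)

lemma spectral_space_cong_AE: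
  assumes "f \<in> spectral_space D" "AE x in lebesgue. f x = g x"
  shows "g \<in> spectral_space D"
  by (rule spectral_spaceI[OF fourier_rel_cong_AE[OF spectral_space_rel[OF assms(1)] assms(2)]])
    (use spectral_space_AE[OF assms(1)] in auto)

lemma L2_linear_subspace_spectral_space: "L2_linear_subspace (spectral_space D)"
  unfolding L2_linear_subspace_def
proof (intro conjI ballI allI)
  show "spectral_space D \<subseteq> L2_fun" by (auto dest: spectral_space_L2)
  show "(\<lambda>x. 0) \<in> spectral_space D"
  proof (rule spectral_spaceI)
    show "fourier_rel (\<lambda>x. 0) (fourier_L1 (\<lambda>x. 0))"
      by (rule fourier_rel_L1[OF L2_fun_zero]) simp
  qed (simp add: fourier_L1_character)
next
  fix f g assume "f \<in> spectral_space D" "g \<in> spectral_space D"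
  then have "AE k in lebesgue. k \<notin> D \<longrightarrow> fourier_L2 f k + fourier_L2 g k = 0"
    using spectral_space_AE[of f D] spectral_space_AE[of g D] by auto
  then show "(\<lambda>x. f x + g x) \<in> spectral_space D"
    by (rule spectral_spaceI[OF fourier_rel_add[OF spectral_space_rel spectral_space_rel], rotated 2]) fact+
next
  fix f c assume "f \<in> spectral_space D"
  then have "AE k in lebesgue. k \<notin> D \<longrightarrow> c * fourier_L2 f k = 0"
    using spectral_space_AE[of f D] by auto
  then show "(\<lambda>x. c * f x) \<in> spectral_space D"
    by (rule spectral_spaceI[OF fourier_rel_scale[OF spectral_space_rel], rotated]) fact
qed

lemma L2_norm_mono:
  assumes "f \<in> L2_fun" "g \<in> L2_fun" "AE x in lebesgue. cmod (f x) \<le> cmod (g x)"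
  shows "L2_norm f \<le> L2_norm g"
  unfolding L2_norm_def
  by (intro real_sqrt_le_mono integral_mono_AE L2_fun_integrable assms)
    (use assms(3) in \<open>auto intro: power_mono\<close>)

text \<open>Let u be the part of the transform of the limit f that lives outside D. The transforms
  of the \<open>F m\<close> vanish there, so the norm of u is at most the distance from
  \<open>F m\<close> to f, which tends to 0.\<close>

lemma L2_closed_subspace_spectral_space:
  fixes D :: "(real ^ 'n) set"
  assumes D: "D \<in> sets lebesgue"
  shows "L2_closed_subspace (spectral_space D)"
  unfolding L2_closed_subspace_def
proof (intro conjI allI impI L2_linear_subspace_spectral_space)
  fix F and f :: "real ^ 'n \<Rightarrow> complex"
  assume "(\<forall>m. F m \<in> spectral_space D) \<and> L2_tendsto F f"
  then have F: "\<And>m. F m \<in> spectral_space D" and lim: "L2_tendsto F f" by auto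
  define h where "h = fourier_L2 f"
  have "f \<in> L2_fun" using lim by (simp add: L2_tendsto_def)
  then have rel: "fourier_rel f h" unfolding h_def by (rule fourier_rel_fourier_L2)
  have h_L2: "h \<in> L2_fun" by (rule fourier_rel_L2_right[OF rel])
  define u where "u k = h k * indicator (- D) k" for k
  have u_L2: "u \<in> L2_fun"
    unfolding u_def by (rule L2_fun_mult_indicator[OF h_L2]) (simp add: Compl_in_sets_lebesgue D)
  have "L2_norm u \<le> L2_norm (\<lambda>x. F m x - f x)" for m
  proof -
    have diff: "fourier_rel (\<lambda>x. F m x - f x) (\<lambda>k. fourier_L2 (F m) k - h k)"
      by (rule fourier_rel_diff[OF spectral_space_rel[OF F] rel])
    have "L2_norm u \<le> L2_norm (\<lambda>k. fourier_L2 (F m) k - h k)"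
    proof (rule L2_norm_mono[OF u_L2 fourier_rel_L2_right[OF diff]])
      show "AE k in lebesgue. cmod (u k) \<le> cmod (fourier_L2 (F m) k - h k)"
        using spectral_space_AE[OF F[of m]]
        by eventually_elim (auto simp: u_def indicator_def)
    qed
    then show ?thesis by (simp only: fourier_rel_norm[OF diff])
  qed
  moreover have "(\<lambda>m. L2_norm (\<lambda>x. F m x - f x)) \<longlonglongrightarrow> 0"
    using lim by (simp add: L2_tendsto_def)
  ultimately have "L2_norm u \<le> 0"
    by (intro LIMSEQ_le_const) auto
  then have "L2_norm u = 0" using L2_norm_nonneg[of u] by simp
  then have "AE k in lebesgue. u k = 0" by (simp only: L2_norm_eq_0_iff[OF u_L2])
  then have "AE k in lebesgue. k \<notin> D \<longrightarrow> h k = 0"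
    by eventually_elim (auto simp: u_def indicator_def split: if_splits)
  then show "f \<in> spectral_space D" by (rule spectral_spaceI[OF rel])
qed

lemma
  fixes D :: "(real ^ 'n) set"
  assumes D: "D \<in> sets lebesgue" "emeasure lebesgue D = ennreal V" "0 \<le> V"
    and h: "h \<in> L2_fun" "AE k in lebesgue. k \<notin> D \<longrightarrow> h k = 0"
  shows integrable_if_supported: "integrable lebesgue h"
    and L1_norm_le_if_supported: "(LINT k|lebesgue. cmod (h k)) \<le> sqrt V * L2_norm h"
proof -
  let ?I = "\<lambda>k. indicator D k :: complex"
  have fin: "emeasure lebesgue D < \<infinity>" using D(2) by simp
  have h_meas [measurable]: "h \<in> borel_measurable lebesgue" by (rule L2_fun_measurable[OF h(1)])
  have ae: "AE k in lebesgue. h k * ?I k = h k"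
    using h(2) by eventually_elim (auto simp: indicator_def)
  have int: "integrable lebesgue (\<lambda>k. h k * ?I k)"
    by (rule integrable_L2_mult_indicator[OF h(1) D(1) fin])
  show "integrable lebesgue h"
    using integrable_cong_AE_imp[OF int h_meas ae] .
  \<comment> \<open>The constant \<open>sqrt V\<close> of the theorem is the L2 norm of the
    indicator of D.\<close>
  have I_norm: "L2_norm ?I = sqrt V"
  proof -
    have "(\<lambda>x. (cmod (indicator D x))\<^sup>2) = indicat_real D"
      by (auto simp: fun_eq_iff indicator_def)
    then show ?thesis using D by (simp add: L2_norm_def measure_def)
  qed
  have "(LINT k|lebesgue. cmod (h k)) = (LINT k|lebesgue. cmod (h k) * cmod (?I k))"
  proof (rule integral_cong_AE)
    show "AE k in lebesgue. cmod (h k) = cmod (h k) * cmod (?I k)"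
      using h(2) by eventually_elim (auto simp: indicator_def)
  qed (use D(1) in measurable)
  also have "\<dots> \<le> L2_norm h * L2_norm ?I"
    by (rule L2_Cauchy_Schwarz[OF h(1) L2_fun_indicator[OF D(1) fin]])
  finally show "(LINT k|lebesgue. cmod (h k)) \<le> sqrt V * L2_norm h"
    by (simp add: I_norm mult.commute)
qed

section \<open>Continuous representatives\<close>

lemma continuous_AE_eq_imp_eq:
  fixes a b :: "'a::euclidean_space \<Rightarrow> 'b::real_normed_vector"
  assumes "continuous_on UNIV a" "continuous_on UNIV b" "AE x in lebesgue. a x = b x"
  shows "a = b"
proof -
  \<comment> \<open>The set of disagreement is open by continuity and null by assumption; a nonempty
    open set is not null.\<close>
  have op: "open {x. a x \<noteq> b x}"
    using assms(1,2) by (rule open_Collect_neq)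
  then have "{x. a x \<noteq> b x} \<in> sets lebesgue"
    by (intro sets_completionI_sets) simp
  then have "{x. a x \<noteq> b x} \<in> null_sets lebesgue"
    using assms(3) by (simp add: AE_iff_null_sets)
  with op have "{x. a x \<noteq> b x} = {}"
    using open_not_negligible negligible_iff_null_sets by blast
  then show ?thesis by auto
qed

lemma is_cont_rep_unique: "is_cont_rep f h \<Longrightarrow> is_cont_rep f k \<Longrightarrow> h = k"
  unfolding is_cont_rep_def by (intro continuous_AE_eq_imp_eq) auto

lemma is_cont_rep_self: "continuous_on UNIV f \<Longrightarrow> is_cont_rep f f"
  by (simp add: is_cont_rep_def)

lemma cont_rep_eqI: "is_cont_rep f h \<Longrightarrow> cont_rep f = h"
  unfolding cont_rep_def by (rule the_equality) (auto intro: is_cont_rep_unique)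

lemma is_cont_rep_fourier_inv:
  assumes D: "D \<in> sets lebesgue" "emeasure lebesgue D = ennreal V" "0 \<le> V"
    and f: "f \<in> spectral_space D"
  shows "is_cont_rep f (fourier_inv (fourier_L2 f))"
proof -
  have "integrable lebesgue (fourier_L2 f)"
    using integrable_if_supported[OF D fourier_rel_L2_right[OF spectral_space_rel[OF f]]
        spectral_space_AE[OF f]] .
  then show ?thesis
    unfolding is_cont_rep_def
    using continuous_fourier_inv fourier_inversion[OF spectral_space_rel[OF f]] by blast
qed

text \<open>A continuous function is its own continuous representative, and membership in the
  spectral space ignores null sets. Identifying elements with their representatives thus amounts to
  keeping the continuous members.\<close>

lemma cont_rep_image_spectral_space:
  assumes D: "D \<in> sets lebesgue" "emeasure lebesgue D = ennreal V" "0 \<le> V"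
  shows "cont_rep ` spectral_space D = {f \<in> spectral_space D. continuous_on UNIV f}"
proof (intro equalityI subsetI)
  fix g assume "g \<in> cont_rep ` spectral_space D"
  then obtain f where f: "f \<in> spectral_space D" and g: "g = cont_rep f" by auto
  have "is_cont_rep f g"
    unfolding g using is_cont_rep_fourier_inv[OF D f] cont_rep_eqI by metis
  then have "continuous_on UNIV g" "AE x in lebesgue. f x = g x"
    by (auto simp: is_cont_rep_def eq_commute)
  then show "g \<in> {f \<in> spectral_space D. continuous_on UNIV f}"
    using spectral_space_cong_AE[OF f] by blast
next
  fix f assume "f \<in> {f \<in> spectral_space D. continuous_on UNIV f}"
  then have "f \<in> spectral_space D" "cont_rep f = f"
    by (auto intro: cont_rep_eqI is_cont_rep_self)
  then show "f \<in> cont_rep ` spectral_space D" by (metis imageI)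
qed

text \<open>Continuity upgrades vanishing almost everywhere to vanishing everywhere, which makes the
  inner product definite. For completeness, the L2 limit is replaced by its continuous
  representative, which is a limit of the same sequence.\<close>

lemma L2_function_Hilbert_space_spectral_space:
  fixes D :: "(real ^ 'n) set"
  assumes D: "D \<in> sets lebesgue" "emeasure lebesgue D = ennreal V" "0 \<le> V"
  shows "L2_function_Hilbert_space {f \<in> spectral_space D. continuous_on UNIV f}"
    (is "L2_function_Hilbert_space ?H")
  unfolding L2_function_Hilbert_space_def
proof (intro conjI ballI allI impI)
  show "L2_linear_subspace ?H"
    using L2_linear_subspace_spectral_space[of D] unfolding L2_linear_subspace_def
    by (auto intro: continuous_intros)
next
  fix f x assume f: "f \<in> ?H" and "L2_inner f f = 0"
  then have "L2_norm f = 0" by (simp add: L2_inner_self)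
  then have "AE x in lebesgue. f x = 0" using f L2_norm_eq_0_iff spectral_space_L2 by blast
  then have "f = (\<lambda>x. 0)" using f by (intro continuous_AE_eq_imp_eq) auto
  then show "f x = 0" by simp
next
  fix F assume "(\<forall>m. F m \<in> ?H) \<and> L2_Cauchy F"
  then have F: "\<And>m. F m \<in> spectral_space D" and "L2_Cauchy F" by auto
  from \<open>L2_Cauchy F\<close> obtain f where lim: "L2_tendsto F f" by (rule Riesz_Fischer)
  with F have f: "f \<in> spectral_space D"
    using L2_closed_subspace_spectral_space[OF D(1)] unfolding L2_closed_subspace_def by blast
  have rep: "is_cont_rep f (cont_rep f)"
    using is_cont_rep_fourier_inv[OF D f] cont_rep_eqI by metis
  then have "AE x in lebesgue. f x = cont_rep f x" by (auto simp: is_cont_rep_def eq_commute)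
  from L2_tendsto_cong_AE[OF lim this] have "L2_tendsto F (cont_rep f)" .
  moreover have "cont_rep f \<in> ?H"
    using f cont_rep_image_spectral_space[OF D] by blast
  ultimately show "\<exists>f\<in>?H. L2_tendsto F f" by blast
qed

section \<open>The reproducing kernel and the sup bound\<close>

lemma g_kernel_character: "g_kernel D x = (LINT k|lebesgue. indicator D k * character (k \<bullet> x))"
  unfolding g_kernel_def set_lebesgue_integral_def character_def
  by (intro Bochner_Integration.integral_cong refl) (simp add: indicator_def)

text \<open>This is the Hermitian symmetry of the kernel. It converts the inner product with
  \<open>K y x\<close> into the integral against \<open>K x y\<close>.\<close>

lemma cnj_g_kernel: "cnj (g_kernel D x) = g_kernel D (- x)"
  unfolding g_kernel_character Bochner_Integration.integral_cnj[symmetric]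
  by (intro Bochner_Integration.integral_cong refl) (simp add: indicator_def cnj_character)

text \<open>Translation by x corresponds to modulation on the transform side, so each section of the
  kernel is the inverse transform of a modulated indicator of D.\<close>

lemma g_kernel_fourier_inv:
  "g_kernel D (y - x) = fourier_inv (\<lambda>k. indicator D k * character (- (x \<bullet> k))) y"
  unfolding g_kernel_character fourier_inv_def
  by (intro Bochner_Integration.integral_cong refl)
    (simp add: inner_diff_right character_add[symmetric] inner_commute mult.assoc)

text \<open>The modulated indicator \<open>u x\<close> is integrable and square-integrable because D
  has finite measure, so it is the L2 transform of the kernel section even where that section fails
  to be integrable. Preservation of inner products then moves the evaluation at x from the transform
  side to f itself.\<close>

lemma L2_RKHS_spectral_space:
  fixes D :: "(real ^ 'n) set"
  assumes D: "D \<in> sets lebesgue" "emeasure lebesgue D = ennreal V" "0 \<le> V"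
  shows "L2_RKHS (cont_rep ` spectral_space D) (\<lambda>x y. g_kernel D (x - y))"
  unfolding L2_RKHS_def cont_rep_image_spectral_space[OF D]
proof (intro conjI allI ballI L2_function_Hilbert_space_spectral_space[OF D])
  let ?H = "{f \<in> spectral_space D. continuous_on UNIV f}"
  define u where "u x k = indicator D k * character (- (x \<bullet> k))" for x k :: "real ^ 'n"
  have kernel: "(\<lambda>y. g_kernel D (y - x)) = fourier_inv (u x)" for x
    by (simp add: g_kernel_fourier_inv u_def[abs_def])
  have fin: "emeasure lebesgue D < \<infinity>" using D(2) by simp
  have u_L2: "u x \<in> L2_fun" for x
  proof (rule L2_fun_dominated[OF _ L2_fun_integrable[OF L2_fun_indicator[OF D(1) fin]]])
    show "u x \<in> borel_measurable lebesgue"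
      unfolding u_def using D(1) by measurable
  qed (simp add: u_def norm_mult)
  have u_supp: "AE k in lebesgue. k \<notin> D \<longrightarrow> u x k = 0" for x
    by (simp add: u_def)
  have u_int: "integrable lebesgue (u x)" for x
    by (rule integrable_if_supported[OF D u_L2 u_supp])
  have u_rel: "fourier_rel (\<lambda>y. g_kernel D (y - x)) (u x)" for x
    unfolding kernel by (rule fourier_rel_fourier_inv[OF u_L2 u_int])
  show "(\<lambda>y. g_kernel D (y - x)) \<in> ?H" for x
    using spectral_spaceI[OF u_rel u_supp] continuous_fourier_inv[OF u_int] by (simp add: kernel)
  fix f x assume "f \<in> ?H"
  then have f: "f \<in> spectral_space D" and cont: "continuous_on UNIV f" by auto
  have h_meas: "fourier_L2 f \<in> borel_measurable lebesgue"
    by (rule L2_fun_measurable[OF fourier_rel_L2_right[OF spectral_space_rel[OF f]]])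
  have "f x = fourier_inv (fourier_L2 f) x"
    using is_cont_rep_unique[OF is_cont_rep_self[OF cont] is_cont_rep_fourier_inv[OF D f]] by simp
  also have "\<dots> = L2_inner (fourier_L2 f) (u x)"
    unfolding fourier_inv_def L2_inner_def
  proof (rule integral_cong_AE)
    \<comment> \<open>On D the conjugate of \<open>u x\<close> is the exponential of the inverse
      transform; off D the transform of f vanishes almost everywhere.\<close>
    show "AE k in lebesgue. fourier_L2 f k * character (x \<bullet> k) = fourier_L2 f k * cnj (u x k)"
      using spectral_space_AE[OF f]
      by eventually_elim (auto simp: u_def indicator_def cnj_character)
    show "(\<lambda>k. fourier_L2 f k * cnj (u x k)) \<in> borel_measurable lebesgue"
      using h_meas L2_fun_measurable[OF L2_fun_cnj[OF u_L2]] by measurable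
    show "(\<lambda>k. fourier_L2 f k * character (x \<bullet> k)) \<in> borel_measurable lebesgue"
      using h_meas by measurable
  qed
  also have "\<dots> = L2_inner f (\<lambda>y. g_kernel D (y - x))"
    by (rule fourier_rel_inner[OF spectral_space_rel[OF f] u_rel])
  finally show *: "f x = L2_inner f (\<lambda>y. g_kernel D (y - x))" .
  show "f x = (LINT y|lebesgue. g_kernel D (x - y) * f y)"
    unfolding * L2_inner_def by (simp add: cnj_g_kernel mult.commute)
qed

text \<open>The bound holds at every point for the inverse transform of \<open>fourier_L2 f\<close>,
  where the isometry has replaced the norm of the transform by that of f; it passes to f off a null
  set, which is all the essential supremum sees.\<close>

lemma Linfty_norm_spectral_space_le:
  assumes D: "D \<in> sets lebesgue" "emeasure lebesgue D = ennreal V" "0 \<le> V"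
    and f: "f \<in> spectral_space D"
  shows "Linfty_norm f \<le> ereal (sqrt V * L2_norm f)"
  unfolding Linfty_norm_def
proof (rule esssup_I)
  show "(\<lambda>x. ereal (cmod (f x))) \<in> borel_measurable lebesgue"
    using L2_fun_measurable[OF spectral_space_L2[OF f]] by measurable
  let ?h = "fourier_L2 f"
  have "cmod (fourier_inv ?h x) \<le> sqrt V * L2_norm f" for x
    using order_trans[OF cmod_fourier_inv_le L1_norm_le_if_supported[OF D
          fourier_rel_L2_right[OF spectral_space_rel[OF f]] spectral_space_AE[OF f]]]
    by (simp add: fourier_rel_norm[OF spectral_space_rel[OF f]])
  moreover have "AE x in lebesgue. fourier_inv ?h x = f x"
    using is_cont_rep_fourier_inv[OF D f] by (simp add: is_cont_rep_def)
  ultimately show "AE x in lebesgue. ereal (cmod (f x)) \<le> ereal (sqrt V * L2_norm f)"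
    by (auto elim!: eventually_mono) metis
qed

theorem theorem2p1:
  fixes D :: "(real ^ 'n) set" and V :: real
  assumes "D \<in> sets lebesgue"
    and "emeasure lebesgue D = ennreal V" and "0 \<le> V"
  shows "L2_closed_subspace (spectral_space D)
    \<and> (\<forall>f \<in> spectral_space D.
          (\<exists>!h. is_cont_rep f h) \<and>
          (\<forall>x. integrable lebesgue
                  (\<lambda>k. fourier_L2 f k * exp (2 * complex_of_real pi * \<i> * complex_of_real (x \<bullet> k))) \<and>
               cont_rep f x =
                 (LINT k|lebesgue.
                    fourier_L2 f k * exp (2 * complex_of_real pi * \<i> * complex_of_real (x \<bullet> k)))))
    \<and> L2_RKHS (cont_rep ` spectral_space D) (\<lambda>x y. g_kernel D (x - y))
    \<and> (\<forall>f \<in> spectral_space D. Linfty_norm f \<le> ereal (sqrt V * L2_norm f))"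
proof (intro conjI ballI allI)
  show "L2_closed_subspace (spectral_space D)"
    by (rule L2_closed_subspace_spectral_space[OF assms(1)])
  show "L2_RKHS (cont_rep ` spectral_space D) (\<lambda>x y. g_kernel D (x - y))"
    by (rule L2_RKHS_spectral_space[OF assms])
  fix f assume f: "f \<in> spectral_space D"
  show "Linfty_norm f \<le> ereal (sqrt V * L2_norm f)"
    by (rule Linfty_norm_spectral_space_le[OF assms f])
  note rep = is_cont_rep_fourier_inv[OF assms f]
  show "\<exists>!h. is_cont_rep f h"
    using rep is_cont_rep_unique by blast
  fix x
  have "integrable lebesgue (fourier_L2 f)"
    by (rule integrable_if_supported[OF assms fourier_rel_L2_right[OF spectral_space_rel[OF f]]
          spectral_space_AE[OF f]])
  from integrable_mult_character(1)[OF this, of x]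
  show "integrable lebesgue
      (\<lambda>k. fourier_L2 f k * exp (2 * complex_of_real pi * \<i> * complex_of_real (x \<bullet> k)))"
    by (simp only: character_def)
  show "cont_rep f x = (LINT k|lebesgue.
      fourier_L2 f k * exp (2 * complex_of_real pi * \<i> * complex_of_real (x \<bullet> k)))"
    by (simp only: cont_rep_eqI[OF rep] fourier_inv_def character_def)
qed

end
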